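(* For each positive integer $k$, write $k = 7^{m_k} k'$ where $m_k \geq 0$ and $\gcd(7, k') = 1$ (so $m_k$ is the exponent of $7$ in $k$), and define \[ d_k = \frac{\sigma(k)}{k}\left(1 + \frac{18}{7^{m_k+1}-1}\right), \qquad e_k = \frac{\sigma(k)}{k}\left(1 + \frac{42}{7^{m_k+1}-1}\right). \] Then for every integer $n \geq 1$, \[ 7\,B_n(1!\,d_1, 2!\,d_2, \dots, n!\,d_n) + 49\,n\,B_{n-1}(1!\,e_1, 2!\,e_2, \dots, (n-1)!\,e_{n-1}) = n!\,p(7n+5). \]
   Context: $\sigma(k)$ denotes the sum of all positive divisors of the positive integer $k$. $p(N)$ denotes the number of partitions of the nonnegative integer $N$. The complete exponential Bell polynomials $B_n(x_1,\dots,x_n)$, $n \geq 0$, are defined by the formal power series identity \[ \exp\Big(\sum_{m=1}^\infty x_m \frac{t^m}{m!}\Big) = \sum_{n=0}^\infty B_n(x_1,\dots,x_n)\frac{t^n}{n!}, \] so in particular $B_0 = 1$; equivalently $B_n = \sum_{k=1}^n B_{n,k}$ for $n\ge1$, where $B_{n,k}(x_1,\dots,x_{n-k+1}) = \sum \frac{n!}{j_1!\cdots j_{n-k+1}!}\prod_{i}\big(\frac{x_i}{i!}\big)^{j_i}$, the sum over nonnegative integers $j_1,\dots,j_{n-k+1}$ with $\sum_i j_i = k$ and $\sum_i i\,j_i = n$. *)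

theory Defs
  imports Complex_Main "HOL-Library.Multiset" "HOL-Computational_Algebra.Computational_Algebra"
begin

definition sigma :: "nat \<Rightarrow> nat" where
  "sigma k = (\<Sum>d | d dvd k. d)"

text \<open>A partition of \<^term>\<open>N\<close> is a finite multiset of positive integers (its parts) with sum
  \<^term>\<open>N\<close>.\<close>

definition partitions :: "nat \<Rightarrow> nat multiset set" where
  "partitions N = {M. 0 \<notin># M \<and> sum_mset M = N}"

definition num_partitions :: "nat \<Rightarrow> nat" where
  "num_partitions N = card (partitions N)"

text \<open>The complete exponential Bell polynomial \<open>B\<^sub>n(x\<^sub>1, \<dots>, x\<^sub>n)\<close>, read off from its exponential
  generating function. The arguments are passed as a sequence, of which only the entries with
  indices \<open>1, \<dots>, n\<close> are used (see \<open>bell_cong\<close>).\<close>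

definition bell :: "nat \<Rightarrow> (nat \<Rightarrow> 'a::field_char_0) \<Rightarrow> 'a" where
  "bell n x =
     fact n * fps_nth (fps_exp 1 oo Abs_fps (\<lambda>m. if m = 0 then 0 else x m / fact m)) n"

lemma bell_generating_function:
  "Abs_fps (\<lambda>n. bell n x / fact n) =
     fps_exp 1 oo Abs_fps (\<lambda>m. if m = 0 then 0 else x m / fact m)"
  by (rule fps_ext) (simp add: bell_def)

lemma fps_power_nth_cong:
  fixes f g :: "'a::comm_ring_1 fps"
  assumes "\<And>i. i \<le> n \<Longrightarrow> fps_nth f i = fps_nth g i" and "j \<le> n"
  shows "fps_nth (f ^ k) j = fps_nth (g ^ k) j"
  using assms(2)
proof (induction k arbitrary: j)
  case (Suc k)
  then show ?case
    using assms(1) by (auto simp: fps_mult_nth intro!: sum.cong)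
qed simp

lemma bell_cong:
  assumes "\<And>i. 1 \<le> i \<Longrightarrow> i \<le> n \<Longrightarrow> x i = y i"
  shows "bell n x = bell n y"
  unfolding bell_def fps_compose_nth
  using assms by (auto intro!: sum.cong fps_power_nth_cong[where n = n])

definition d_seq :: "nat \<Rightarrow> real" where
  "d_seq k = real (sigma k) / real k * (1 + 18 / (7 ^ (multiplicity 7 k + 1) - 1))"

definition e_seq :: "nat \<Rightarrow> real" where
  "e_seq k = real (sigma k) / real k * (1 + 42 / (7 ^ (multiplicity 7 k + 1) - 1))"

end

theory Submission
  imports Defs "HOL-Library.Nat_Bijection"
begin

text \<open>
  Exponentiating \<open>\<Sum> d\<^sub>k q\<^sup>k\<close> and \<open>\<Sum> e\<^sub>k q\<^sup>k\<close> yields the products \<open>E(q\<^sup>7)\<^sup>3 / E(q)\<^sup>4\<close> and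
  \<open>E(q\<^sup>7)\<^sup>7 / E(q)\<^sup>8\<close>, where \<open>E(q) = \<Prod> (1 - q\<^sup>n)\<close>, so the claim is Ramanujan's identity
  \<open>\<Sum> p(7n+5) q\<^sup>n = 7 E(q\<^sup>7)\<^sup>3 / E(q)\<^sup>4 + 49 q E(q\<^sup>7)\<^sup>7 / E(q)\<^sup>8\<close>.
  Let \<open>a, b, c, d\<close> be the parts of \<open>E\<close> with exponents congruent to 0, 1, 5, 2 modulo 7. By the
  pentagonal number theorem \<open>E = a + b + c + d\<close> with \<open>d = -q\<^sup>2 E(q\<^bsup>49\<^esup>)\<close>, and comparing residue
  classes of exponents in Jacobi's series for \<open>E\<^sup>3\<close> gives \<open>abc = d\<^sup>3\<close>,
  \<open>a\<^sup>2d + ab\<^sup>2 + cd\<^sup>2 = 0\<close>, \<open>b\<^sup>2d + ad\<^sup>2 + bc\<^sup>2 = 0\<close> and \<open>a\<^sup>2c + bd\<^sup>2 + c\<^sup>2d = 0\<close>.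
  The norm \<open>N = \<Prod> E(\<zeta>\<^sup>k q)\<close> over the seventh roots of unity is \<open>E(q\<^sup>7)\<^sup>8 / E(q\<^bsup>49\<^esup>)\<close> as a product,
  while the relations turn it into \<open>-K\<^sup>2 / d\<close> with \<open>K = a\<^sup>3b + b\<^sup>3c + c\<^sup>3a + 8d\<^sup>4\<close>; hence
  \<open>K = \<plusminus> q E(q\<^sup>7)\<^sup>4\<close>, and \<open>p(5) \<ge> 0\<close> decides for the minus sign. They also reduce the part of the
  cofactor \<open>N / E\<close> with exponents 5 modulo 7 to \<open>49 d\<^sup>6 - 7 d\<^sup>2 K\<close>, and \<open>1 / E = (N / E) / N\<close>.
\<close>

subsection \<open>Congruences modulo powers of \<open>X\<close>\<close>

lemma fps_X_power_dvd_iff: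
  "fps_X ^ n dvd (f :: 'a::comm_ring_1 fps) \<longleftrightarrow> (\<forall>i<n. f $ i = 0)"
proof
  assume "fps_X ^ n dvd f"
  then show "\<forall>i<n. f $ i = 0" by (auto simp: fps_X_power_mult_nth elim!: dvdE)
next
  assume "\<forall>i<n. f $ i = 0"
  then have "f = fps_X ^ n * fps_shift n f"
    by (auto simp: fps_eq_iff fps_X_power_mult_nth)
  then show "fps_X ^ n dvd f" by (metis dvd_triv_left)
qed

text \<open>Agreement modulo every power of \<open>fps_X\<close> takes the place of a limit:
  identities for infinite products and series are proved on finite truncations and transferred by
  this rule.\<close>

lemma fps_eqI_dvd:
  fixes f g :: "'a::comm_ring_1 fps"
  assumes "\<And>n. fps_X ^ n dvd f - g"
  shows "f = g"
proof (rule fps_ext)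
  fix n
  show "f $ n = g $ n"
    using assms[of "Suc n"] unfolding fps_X_power_dvd_iff by simp
qed

lemma fps_X_power_dvd_compose:
  fixes f u :: "'a::idom fps"
  assumes "u $ 0 = 0" "fps_X ^ n dvd f"
  shows "fps_X ^ n dvd f oo u"
proof -
  obtain g where g: "f = fps_X ^ n * g" using assms(2) by (elim dvdE)
  have "f oo u = u ^ n * (g oo u)"
    using assms(1)
    by (simp add: g fps_compose_mult_distrib fps_compose_power[symmetric]
        fps_X_fps_compose_startby0)
  moreover have "fps_X dvd u"
    using fps_X_power_dvd_iff[of 1 u] assms(1) by simp
  then have "fps_X ^ n dvd u ^ n" by (rule dvd_power_same)
  ultimately show ?thesis by simp
qed

lemma dvd_diff_mult:
  fixes x :: "'a::comm_ring_1"
  assumes "x dvd a - b" "x dvd c - d"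
  shows "x dvd a * c - b * d"
proof -
  have "a * c - b * d = (a - b) * c + b * (c - d)" by (simp add: algebra_simps)
  then show ?thesis using assms by simp
qed

lemma dvd_diff_power:
  fixes x :: "'a::comm_ring_1"
  assumes "x dvd a - b"
  shows "x dvd a ^ n - b ^ n"
  by (induction n) (simp_all add: assms dvd_diff_mult)

lemma dvd_diff_prod:
  fixes x :: "'a::comm_ring_1"
  assumes "\<And>i. i \<in> A \<Longrightarrow> x dvd f i - g i"
  shows "x dvd prod f A - prod g A"
  using assms by (induction A rule: infinite_finite_induct) (simp_all add: dvd_diff_mult)

lemma dvd_diff_trans:
  fixes x :: "'a::comm_ring_1"
  assumes "x dvd a - b" "x dvd b - c"
  shows "x dvd a - c"
  using dvd_add[OF assms] by simp

lemma dvd_diff_swap: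
  fixes x :: "'a::comm_ring_1"
  shows "x dvd a - b \<Longrightarrow> x dvd b - a"
  using dvd_minus_iff[of x "a - b"] by simp

section \<open>Truncated and infinite Euler products\<close>

definition qpoch :: "'a::comm_ring_1 \<Rightarrow> nat \<Rightarrow> 'a" where
  "qpoch q n = (\<Prod>i=1..n. 1 - q ^ i)"

lemma qpoch_0 [simp]: "qpoch q 0 = 1"
  by (simp add: qpoch_def)

lemma qpoch_Suc: "qpoch q (Suc n) = (1 - q ^ Suc n) * qpoch q n"
  by (simp add: qpoch_def mult.commute)

text \<open>The infinite product of all \<open>1 - fps_X ^ i\<close>, encoded without convergence:
  factors with \<open>i > n\<close> do not affect coefficient \<open>n\<close>, so the
  \<open>n\<close>-th partial product already supplies it.\<close>

definition euler_fps :: "'a::comm_ring_1 fps" where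
  "euler_fps = Abs_fps (\<lambda>n. qpoch fps_X n $ n)"

lemma qpoch_nth_stable:
  assumes "i \<le> m" "m \<le> n"
  shows "qpoch fps_X n $ i = (qpoch fps_X m $ i :: 'a::comm_ring_1)"
  using assms(2)
proof (induction n rule: dec_induct)
  case (step n)
  have "qpoch fps_X (Suc n) = qpoch fps_X n - fps_X ^ Suc n * (qpoch fps_X n :: 'a fps)"
    unfolding qpoch_Suc by (simp only: left_diff_distrib mult_1)
  then show ?case
    using step assms(1) by (simp only: fps_sub_nth fps_X_power_mult_nth) simp
qed simp

lemma euler_fps_cong: "fps_X ^ Suc n dvd (euler_fps - qpoch fps_X n :: 'a::comm_ring_1 fps)"
  unfolding fps_X_power_dvd_iff euler_fps_def
  using qpoch_nth_stable[OF order_refl, of _ n, where 'a = 'a] by auto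

lemma euler_fps_cong':
  assumes "k \<le> Suc n"
  shows "fps_X ^ k dvd (euler_fps - qpoch fps_X n :: 'a::comm_ring_1 fps)"
  using power_le_dvd[OF euler_fps_cong assms] .

lemma qpoch_nth_0 [simp]: "qpoch fps_X n $ 0 = 1"
  by (induction n) (simp_all add: qpoch_Suc del: power_Suc)

lemma euler_fps_nth_0 [simp]: "euler_fps $ 0 = 1"
  by (simp add: euler_fps_def)

lemma qpoch_neq_0 [simp]: "(qpoch fps_X n :: 'a::comm_ring_1 fps) \<noteq> 0"
  by (metis fps_zero_nth qpoch_nth_0 zero_neq_one)

lemma qpoch_compose:
  fixes u :: "'a::idom fps"
  assumes "u $ 0 = 0"
  shows "qpoch fps_X n oo u = qpoch u n"
  using assms
  by (induction n)
    (simp_all add: qpoch_Suc fps_compose_mult_distrib fps_compose_sub_distrib fps_compose_power[symmetric]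
      fps_X_fps_compose_startby0 del: power_Suc)

lemma euler_fps_compose_cong:
  fixes u :: "'a::idom fps"
  assumes "u $ 0 = 0" "k \<le> Suc n"
  shows "fps_X ^ k dvd (euler_fps oo u) - qpoch u n"
  using fps_X_power_dvd_compose[OF assms(1) euler_fps_cong'[OF assms(2)]]
  by (simp add: fps_compose_sub_distrib qpoch_compose assms(1))

subsection \<open>Partitions\<close>

text \<open>Positive parts with sum \<open>n\<close> are at most \<open>n\<close> in number and in
  size. Finiteness matters because \<open>card\<close> is 0 on infinite sets.\<close>

lemma finite_partitions: "finite (partitions n)"
proof (rule finite_subset)
  show "partitions n \<subseteq> mset ` {xs. set xs \<subseteq> {..n} \<and> length xs \<le> n}"
  proof
    fix M assume M: "M \<in> partitions n"
    obtain xs where xs: "M = mset xs" by (metis ex_mset)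
    have le: "x \<le> sum_list xs" if "x \<in> set xs" for x
      using that by (intro member_le_sum_list) simp_all
    have len: "length ys \<le> sum_list ys" if "0 \<notin> set ys" for ys :: "nat list"
      using that by (induction ys) auto
    have "set xs \<subseteq> {..n}" "length xs \<le> n"
      using M le len[of xs] by (auto simp: partitions_def xs sum_mset_sum_list)
    then show "M \<in> mset ` {xs. set xs \<subseteq> {..n} \<and> length xs \<le> n}" using xs by blast
  qed
  show "finite (mset ` {xs. set xs \<subseteq> {..n} \<and> length xs \<le> n})"
    by (intro finite_imageI finite_lists_length_le) simp
qed

definition bounded_partitions :: "nat \<Rightarrow> nat \<Rightarrow> nat multiset set" where
  "bounded_partitions m n = {M \<in> partitions n. \<forall>x\<in>#M. x \<le> m}"

lemma finite_bounded_partitions: "finite (bounded_partitions m n)"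
  using finite_partitions unfolding bounded_partitions_def by simp

lemma bounded_partitions_0: "bounded_partitions 0 n = (if n = 0 then {{#}} else {})"
proof -
  have "M = {#}" if "0 \<notin># M" "\<forall>x\<in>#M. x \<le> 0" for M :: "nat multiset"
    using that by (metis le_zero_eq multiset_nonemptyE)
  then have "bounded_partitions 0 n \<subseteq> {{#}}"
    unfolding bounded_partitions_def partitions_def by blast
  moreover have "{#} \<in> bounded_partitions 0 n \<longleftrightarrow> n = 0"
    by (auto simp: bounded_partitions_def partitions_def)
  ultimately show ?thesis by (cases "n = 0") auto
qed

lemma bounded_partitions_eq:
  assumes "n \<le> m"
  shows "bounded_partitions m n = partitions n"
proof -
  have "x \<le> m" if "M \<in> partitions n" "x \<in># M" for M x
    using that assms by (auto simp: partitions_def dest!: multi_member_split)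
  then show ?thesis by (auto simp: bounded_partitions_def)
qed

text \<open>Partitions are split by whether the largest admissible part \<open>Suc m\<close> occurs;
  if it does, one copy is removed.\<close>

lemma card_bounded_partitions_Suc:
  "card (bounded_partitions (Suc m) n) =
     card (bounded_partitions m n) +
     (if Suc m \<le> n then card (bounded_partitions (Suc m) (n - Suc m)) else 0)"
proof -
  let ?T = "{M \<in> bounded_partitions (Suc m) n. Suc m \<in># M}"
  have eq: "bounded_partitions (Suc m) n = bounded_partitions m n \<union> ?T"
    by (auto simp: bounded_partitions_def) (metis le_SucE)
  have "card (bounded_partitions (Suc m) n) = card (bounded_partitions m n) + card ?T"
    by (subst eq, rule card_Un_disjoint)
      (auto simp: finite_bounded_partitions, auto simp: bounded_partitions_def)
  moreover have "card ?T = (if Suc m \<le> n then card (bounded_partitions (Suc m) (n - Suc m)) else 0)"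
  proof (cases "Suc m \<le> n")
    case True
    have "bij_betw (add_mset (Suc m)) (bounded_partitions (Suc m) (n - Suc m)) ?T"
    proof (rule bij_betwI[where g = "\<lambda>M. M - {#Suc m#}"])
      show "add_mset (Suc m) \<in> bounded_partitions (Suc m) (n - Suc m) \<rightarrow> ?T"
        using True by (auto simp: bounded_partitions_def partitions_def)
      show "(\<lambda>M. M - {#Suc m#}) \<in> ?T \<rightarrow> bounded_partitions (Suc m) (n - Suc m)"
        by (auto simp: bounded_partitions_def partitions_def sum_mset_diff dest: in_diffD)
    qed auto
    then show ?thesis using True by (simp add: bij_betw_same_card)
  next
    case False
    then have "?T = {}"
      by (auto simp: bounded_partitions_def partitions_def dest!: multi_member_split)
    then show ?thesis using False by (simp only: card.empty if_False)
  qed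
  ultimately show ?thesis by simp
qed

lemma bounded_partitions_gf:
  "Abs_fps (\<lambda>n. of_nat (card (bounded_partitions m n))) * qpoch fps_X m = (1 :: 'a::comm_ring_1 fps)"
proof (induction m)
  case 0
  then show ?case by (simp add: bounded_partitions_0 fps_eq_iff)
next
  case (Suc m)
  let ?G = "\<lambda>m. Abs_fps (\<lambda>n. of_nat (card (bounded_partitions m n))) :: 'a fps"
  have "?G (Suc m) = ?G m + fps_X ^ Suc m * ?G (Suc m)"
    by (rule fps_ext) (simp add: fps_X_power_mult_nth card_bounded_partitions_Suc del: power_Suc)
  then have "(1 - fps_X ^ Suc m) * ?G (Suc m) = ?G m"
    by (simp add: algebra_simps del: power_Suc)
  then show ?case
    using Suc by (simp add: qpoch_Suc ac_simps del: power_Suc)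
qed

text \<open>Below degree \<open>m\<close> the bound \<open>m\<close> on the parts is no restriction,
  so the finite identity \<open>bounded_partitions_gf\<close> holds modulo \<open>fps_X ^ m\<close>
  for the full series.\<close>

theorem partitions_gf:
  "Abs_fps (\<lambda>n. of_nat (num_partitions n)) * euler_fps = (1 :: 'a::comm_ring_1 fps)"
proof (rule fps_eqI_dvd)
  fix m
  let ?G = "Abs_fps (\<lambda>n. of_nat (card (bounded_partitions m n))) :: 'a fps"
  let ?P = "Abs_fps (\<lambda>n. of_nat (num_partitions n)) :: 'a fps"
  have "fps_X ^ m dvd ?P - ?G"
    by (auto simp: fps_X_power_dvd_iff bounded_partitions_eq num_partitions_def)
  then have "fps_X ^ m dvd ?P * euler_fps - ?G * qpoch fps_X m"
    by (intro dvd_diff_mult euler_fps_cong') simp_all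
  then show "fps_X ^ m dvd ?P * euler_fps - 1"
    by (simp add: bounded_partitions_gf)
qed

subsection \<open>The pentagonal number theorem\<close>

text \<open>The generalized pentagonal numbers. The product is nonnegative for every integer
  \<open>k\<close>, so \<open>nat\<close> loses nothing.\<close>

definition pent :: "int \<Rightarrow> nat" where
  "pent k = nat (k * (3 * k - 1) div 2)"

definition pent_sum :: "'a::comm_ring_1 \<Rightarrow> nat \<Rightarrow> 'a" where
  "pent_sum q n = (\<Sum>k\<in>{-int n..int n}. (if even k then 1 else -1) * q ^ pent k)"

lemma two_triangle: "2 * int (triangle n) = int n * (int n + 1)"
  by (induction n) (simp_all add: algebra_simps)

lemma two_pent: "2 * int (pent k) = k * (3 * k - 1)"
proof -
  have "k * (3 * k - 1) \<ge> 0" by (cases "k \<ge> 1") (auto simp: zero_le_mult_iff)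
  then show ?thesis by (simp add: pent_def)
qed

lemma pent_of_nat: "pent (int (Suc n)) = Suc n * Suc n + triangle n"
  using two_pent[of "int (Suc n)"] two_triangle[of n]
  by (subst of_nat_eq_iff[where 'a = int, symmetric]) (simp add: algebra_simps)

lemma pent_minus_of_nat: "pent (- int n) = n * n + triangle n"
  using two_pent[of "- int n"] two_triangle[of n]
  by (subst of_nat_eq_iff[where 'a = int, symmetric]) (simp add: algebra_simps)

lemma pent_sum_Suc:
  "pent_sum q (Suc n) = pent_sum q n
     + (-1) ^ Suc n * (q ^ (Suc n * Suc n + triangle n) + q ^ (Suc n * Suc n + triangle (Suc n)))"
proof -
  have "{-int (Suc n)..int (Suc n)} = insert (int (Suc n)) (insert (- int (Suc n)) {-int n..int n})"
    by auto
  then show ?thesis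
    by (simp add: pent_sum_def pent_of_nat pent_minus_of_nat algebra_simps uminus_power_if
        del: of_nat_Suc triangle_Suc)
qed

text \<open>Shanks' finite form of the pentagonal number theorem: the left-hand side tends to the
  Euler product because only its summand \<open>s = 0\<close> survives.\<close>

theorem shanks:
  fixes q :: "'a::comm_ring_1"
  shows "(\<Sum>s\<le>n. (-1) ^ s * (\<Prod>i=Suc s..n. 1 - q ^ i) * q ^ (s * n + triangle s)) = pent_sum q n"
proof (induction n)
  case 0
  then show ?case by (simp add: pent_sum_def pent_def)
next
  case (Suc n)
  define T where "T m s = (-1) ^ s * (\<Prod>i=Suc s..m. 1 - q ^ i) * q ^ (s * m + triangle s)" for m s
  have T_Suc: "T (Suc n) s = T n s * q ^ s - T n s * q ^ (s + Suc n)" if "s \<le> n" for s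
  proof -
    have *: "(\<Prod>i=Suc s..Suc n. 1 - q ^ i) = (\<Prod>i=Suc s..n. 1 - q ^ i) * (1 - q ^ Suc n)"
      using that by simp
    show ?thesis
      unfolding T_def * by (simp add: algebra_simps power_add)
  qed
  have T_shift: "T n (Suc s) * (1 - q ^ Suc s) = - (T n s * q ^ (s + Suc n))" if "s < n" for s
  proof -
    have "(\<Prod>i=Suc s..n. 1 - q ^ i) = (1 - q ^ Suc s) * (\<Prod>i=Suc (Suc s)..n. 1 - q ^ i)"
      using that by (simp add: prod.atLeast_Suc_atMost del: power_Suc)
    moreover have "q ^ (Suc s * n + triangle (Suc s)) = q ^ (s * n + triangle s) * q ^ (s + Suc n)"
      by (simp add: power_add[symmetric] algebra_simps)
    moreover have "(-1 :: 'a) ^ Suc s = - ((-1) ^ s)" by simp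
    ultimately show ?thesis
      unfolding T_def by (simp only:) (simp add: ac_simps del: power_Suc)
  qed
  \<comment> \<open>The summand \<open>s = 0\<close> vanishes, and \<open>T_shift\<close> turns the
    others into terms with \<open>q ^ (s + Suc n)\<close>. These cancel against the second half of
    \<open>T_Suc\<close>, except for the one at \<open>s = n\<close>.\<close>
  have "(\<Sum>s\<le>n. T n s * (1 - q ^ s)) = (\<Sum>s<n. T n (Suc s) * (1 - q ^ Suc s))"
    unfolding lessThan_Suc_atMost[symmetric] by (subst sum.lessThan_Suc_shift) simp
  also have "\<dots> = - (\<Sum>s<n. T n s * q ^ (s + Suc n))"
    using T_shift by (simp add: sum_negf del: power_Suc)
  finally have *: "(\<Sum>s\<le>n. T n s * q ^ s) = (\<Sum>s\<le>n. T n s) + (\<Sum>s<n. T n s * q ^ (s + Suc n))"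
    by (simp add: right_diff_distrib sum_subtractf algebra_simps)
  have "(\<Sum>s\<le>n. T (Suc n) s) = (\<Sum>s\<le>n. T n s * q ^ s) - (\<Sum>s\<le>n. T n s * q ^ (s + Suc n))"
    using T_Suc by (simp add: sum_subtractf del: power_Suc)
  also have "\<dots> = (\<Sum>s\<le>n. T n s) - T n n * q ^ (n + Suc n)"
    unfolding * unfolding lessThan_Suc_atMost[symmetric] by simp
  finally have "(\<Sum>s\<le>Suc n. T (Suc n) s) = (\<Sum>s\<le>n. T n s) - T n n * q ^ (n + Suc n) + T (Suc n) (Suc n)"
    by simp
  also have "T n n * q ^ (n + Suc n) = (-1) ^ n * q ^ (Suc n * Suc n + triangle n)"
    by (simp add: T_def power_add[symmetric] algebra_simps)
  also have "T (Suc n) (Suc n) = (-1) ^ Suc n * q ^ (Suc n * Suc n + triangle (Suc n))"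
    by (simp add: T_def)
  also have "(\<Sum>s\<le>n. T n s) = pent_sum q n"
    using Suc by (simp add: T_def)
  finally show ?case
    by (simp add: T_def pent_sum_Suc algebra_simps del: triangle_Suc)
qed

theorem euler_fps_cong_pent_sum:
  "fps_X ^ Suc n dvd (euler_fps - pent_sum fps_X n :: 'a::comm_ring_1 fps)"
proof (rule dvd_diff_trans[OF euler_fps_cong])
  let ?T = "\<lambda>s. (-1) ^ s * (\<Prod>i=Suc s..n. 1 - fps_X ^ i) * fps_X ^ (s * n + triangle s) :: 'a fps"
  have "pent_sum fps_X n = qpoch fps_X n + (\<Sum>s<n. ?T (Suc s))"
    unfolding shanks[symmetric] lessThan_Suc_atMost[symmetric]
    by (subst sum.lessThan_Suc_shift) (simp add: qpoch_def)
  moreover have "fps_X ^ Suc n dvd ?T (Suc s)" for s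
    by (intro dvd_mult le_imp_power_dvd) simp
  then have "fps_X ^ Suc n dvd (\<Sum>s<n. ?T (Suc s))" by (intro dvd_sum)
  ultimately have "fps_X ^ Suc n dvd (pent_sum fps_X n - qpoch fps_X n :: 'a fps)"
    by (simp only: add_diff_cancel_left')
  then show "fps_X ^ Suc n dvd (qpoch fps_X n - pent_sum fps_X n :: 'a fps)"
    by (rule dvd_diff_swap)
qed

subsection \<open>Jacobi's identity for the cube of the Euler product\<close>

fun qbinom :: "'a::comm_ring_1 \<Rightarrow> nat \<Rightarrow> nat \<Rightarrow> 'a" where
  "qbinom q m 0 = 1"
| "qbinom q 0 (Suc j) = 0"
| "qbinom q (Suc m) (Suc j) = qbinom q m j + q ^ Suc j * qbinom q m (Suc j)"

lemma qbinom_eq_0: "m < j \<Longrightarrow> qbinom q m j = 0"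
  by (induction q m j rule: qbinom.induct) auto

text \<open>The quotient formula for Gaussian binomials, cleared of denominators. The induction step
  splits \<open>1 - q ^ Suc m\<close> as
  \<open>(1 - q ^ Suc j) + q ^ Suc j * (1 - q ^ (m - j))\<close>.\<close>

lemma qbinom_qpoch: "j \<le> m \<Longrightarrow> qbinom q m j * qpoch q j * qpoch q (m - j) = qpoch q m"
proof (induction q m j rule: qbinom.induct)
  case (3 q m j)
  have "qbinom q m (Suc j) * qpoch q (Suc j) * qpoch q (m - j) = (1 - q ^ (m - j)) * qpoch q m"
  proof (cases "j < m")
    case True
    then have "m - j = Suc (m - Suc j)" by simp
    then have "qpoch q (m - j) = (1 - q ^ (m - j)) * qpoch q (m - Suc j)"
      by (metis qpoch_Suc)
    then have "qbinom q m (Suc j) * qpoch q (Suc j) * qpoch q (m - j)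
        = (1 - q ^ (m - j)) * (qbinom q m (Suc j) * qpoch q (Suc j) * qpoch q (m - Suc j))"
      by (simp only: ac_simps)
    then show ?thesis using True 3(2) by simp
  next
    case False
    then show ?thesis using 3(3) by (simp add: qbinom_eq_0)
  qed
  moreover have "qbinom q m j * qpoch q (Suc j) * qpoch q (m - j)
      = (1 - q ^ Suc j) * (qbinom q m j * qpoch q j * qpoch q (m - j))"
    by (simp only: qpoch_Suc ac_simps)
  then have "qbinom q m j * qpoch q (Suc j) * qpoch q (m - j) = (1 - q ^ Suc j) * qpoch q m"
    using 3(1,3) by simp
  moreover have "q ^ Suc m = q ^ Suc j * q ^ (m - j)"
    using 3(3) by (simp flip: power_add power_Suc)
  ultimately have "qbinom q m j * qpoch q (Suc j) * qpoch q (m - j)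
      + q ^ Suc j * (qbinom q m (Suc j) * qpoch q (Suc j) * qpoch q (m - j)) = (1 - q ^ Suc m) * qpoch q m"
    by (simp only:) (simp add: algebra_simps del: power_Suc)
  then show ?case
    by (simp add: qpoch_Suc[of q m] distrib_right mult.assoc del: power_Suc)
qed auto

text \<open>The recursion hides the symmetry, but the product formula shows it, and its factors
  \<open>qpoch\<close> are nonzero power series and can be cancelled.\<close>

lemma qbinom_symmetric:
  assumes "j \<le> m"
  shows "qbinom fps_X m (m - j) = (qbinom fps_X m j :: 'a::idom fps)"
proof -
  have "qbinom fps_X m (m - j) * (qpoch fps_X j * qpoch fps_X (m - j))
      = (qbinom fps_X m j * (qpoch fps_X j * qpoch fps_X (m - j)) :: 'a fps)"
    using qbinom_qpoch[of j m "fps_X :: 'a fps"] qbinom_qpoch[of "m - j" m "fps_X :: 'a fps"] assms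
    by (simp add: ac_simps)
  then show ?thesis by simp
qed

text \<open>The homogeneous form with \<open>w\<close> allows \<open>w = q ^ n\<close> later,
  avoiding negative powers of \<open>q\<close>. The induction splits off the factor
  \<open>i = 0\<close> and replaces \<open>z\<close> by \<open>z * q\<close>.\<close>

theorem q_binomial:
  fixes q w z :: "'a::comm_ring_1"
  shows "(\<Prod>i<m. w + z * q ^ i) = (\<Sum>j\<le>m. q ^ (j choose 2) * qbinom q m j * w ^ (m - j) * z ^ j)"
proof (induction m arbitrary: z)
  case (Suc m)
  have choose: "Suc j choose 2 = (j choose 2) + j" for j
    by (simp add: numeral_2_eq_2)
  let ?S = "\<Sum>j\<le>m. q ^ ((j choose 2) + j) * qbinom q m j * w ^ (m - j) * z ^ j"
  have "(\<Prod>i<m. w + (z * q) * q ^ i) = ?S"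
    unfolding Suc by (simp add: power_add power_mult_distrib ac_simps)
  then have "(\<Prod>i<Suc m. w + z * q ^ i) = w * ?S + z * ?S"
    by (subst prod.lessThan_Suc_shift) (simp add: algebra_simps)
  moreover have "w * ?S = (\<Sum>j\<le>Suc m. q ^ ((j choose 2) + j) * qbinom q m j * w ^ (Suc m - j) * z ^ j)"
    by (auto simp: qbinom_eq_0 sum_distrib_left Suc_diff_le intro!: sum.cong)
  then have "w * ?S = w ^ Suc m
      + (\<Sum>j\<le>m. q ^ ((Suc j choose 2) + Suc j) * qbinom q m (Suc j) * w ^ (m - j) * z ^ Suc j)"
    by (subst (asm) sum.atMost_Suc_shift) (simp add: numeral_2_eq_2)
  moreover have "z * ?S = (\<Sum>j\<le>m. q ^ (Suc j choose 2) * qbinom q m j * w ^ (m - j) * z ^ Suc j)"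
    by (simp add: sum_distrib_left choose ac_simps)
  moreover have "(\<Sum>j\<le>Suc m. q ^ (j choose 2) * qbinom q (Suc m) j * w ^ (Suc m - j) * z ^ j)
     = w ^ Suc m + (\<Sum>j\<le>m. q ^ (Suc j choose 2) * qbinom q (Suc m) (Suc j) * w ^ (m - j) * z ^ Suc j)"
    by (subst sum.atMost_Suc_shift) (simp add: binomial_eq_0)
  moreover have "(\<Sum>j\<le>m. q ^ (Suc j choose 2) * qbinom q (Suc m) (Suc j) * w ^ (m - j) * z ^ Suc j)
     = (\<Sum>j\<le>m. q ^ (Suc j choose 2) * qbinom q m j * w ^ (m - j) * z ^ Suc j)
       + (\<Sum>j\<le>m. q ^ ((Suc j choose 2) + Suc j) * qbinom q m (Suc j) * w ^ (m - j) * z ^ Suc j)"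
    unfolding sum.distrib[symmetric]
    by (rule sum.cong) (simp_all only: qbinom.simps power_add distrib_left distrib_right ac_simps)
  ultimately show ?case
    by (simp only: ac_simps)
qed (simp add: binomial_eq_0)

definition jacobi_sum :: "'a::comm_ring_1 \<Rightarrow> nat \<Rightarrow> 'a" where
  "jacobi_sum q n = (\<Sum>k\<le>n. (-1) ^ k * of_nat (2 * k + 1) * q ^ triangle k)"

lemma two_choose_two: "2 * int (n choose 2) = int n * (int n - 1)"
  by (induction n) (simp_all add: numeral_2_eq_2 algebra_simps)

lemma qbinom_poly: "qbinom [:q:] m j = [:qbinom q m j:]"
  by (induction q m j rule: qbinom.induct) (simp_all add: poly_const_pow one_pCons del: power_Suc)

text \<open>The factor \<open>i = n\<close> of the product in the \<open>q\<close>-binomial theorem with \<open>w = q\<^sup>n\<close> and \<open>z = -Z\<close>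
  vanishes at \<open>Z = 1\<close>, so differentiating at \<open>Z = 1\<close> leaves the product of the other factors.\<close>

lemma jacobi_finite_aux:
  fixes q :: "'a::idom"
  shows "- (q ^ n * (\<Prod>i\<in>{..2 * n} - {n}. q ^ n - q ^ i))
      = (\<Sum>j\<le>2 * n + 1. (-1) ^ j * of_nat j * q ^ ((j choose 2) + n * (2 * n + 1 - j)) * qbinom q (2 * n + 1) j)"
proof -
  let ?Z = "[:0, -1:] :: 'a poly"
  have LR: "(\<Prod>i\<le>2 * n. [:q ^ n, -(q ^ i):])
      = (\<Sum>j\<le>2 * n + 1. [:q ^ ((j choose 2) + n * (2 * n + 1 - j)) * qbinom q (2 * n + 1) j:] * ?Z ^ j)"
    (is "?L = ?R")
    using q_binomial[of "[:q ^ n:]" ?Z "[:q:]" "2 * n + 1"]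
    by (simp add: qbinom_poly poly_const_pow lessThan_Suc_atMost power_add power_mult ac_simps
        del: sum.atMost_Suc qbinom.simps)
  have "?L = [:q ^ n, -(q ^ n):] * (\<Prod>i\<in>{..2 * n} - {n}. [:q ^ n, -(q ^ i):])"
    by (rule prod.remove) auto
  moreover have *: "poly (pderiv ([:c, - c:] * p)) 1 = - (c * poly p 1)" for c and p :: "'a poly"
    unfolding pderiv_mult by (simp add: pderiv_pCons)
  ultimately have lhs: "poly (pderiv ?L) 1 = - (q ^ n * (\<Prod>i\<in>{..2 * n} - {n}. q ^ n - q ^ i))"
    by (simp only: * poly_prod) simp
  have pderiv_Z: "poly (pderiv (?Z ^ j)) 1 = (-1) ^ j * of_nat j" for j
    unfolding pderiv_power poly_smult poly_mult poly_power
    by (cases j) (simp_all add: pderiv_pCons)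
  have pderiv_sum: "pderiv (sum f A) = (\<Sum>j\<in>A. pderiv (f j))" for f :: "nat \<Rightarrow> 'a poly" and A
    using higher_pderiv_sum[of 1 f A] by simp
  have "poly (pderiv ?R) 1 = (\<Sum>j\<le>2 * n + 1. (-1) ^ j * of_nat j
      * q ^ ((j choose 2) + n * (2 * n + 1 - j)) * qbinom q (2 * n + 1) j)"
    by (simp add: pderiv_Z pderiv_sum poly_sum pderiv_smult algebra_simps del: sum.atMost_Suc qbinom.simps)
  then show ?thesis using LR lhs by simp
qed

text \<open>In \<open>jacobi_finite_aux\<close> the summands \<open>j = n - k\<close> and
  \<open>j = n + 1 + k\<close> have equal Gaussian binomials and equal powers of \<open>q\<close>
  but opposite signs, so their weights combine to
  \<open>(n - k) - (n + 1 + k) = - (2 * k + 1)\<close>.\<close>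

theorem jacobi_finite:
  "qpoch fps_X n ^ 2 = (\<Sum>k\<le>n. (-1) ^ k * of_nat (2 * k + 1) * fps_X ^ triangle k
      * qbinom fps_X (2 * n + 1) (n - k) :: 'a::idom fps)"
proof -
  let ?q = "fps_X :: 'a fps"
  \<comment> \<open>The power of \<open>q\<close> common to both sides: \<open>n\<close> from the
    leading factor, \<open>n choose 2\<close> from the factors \<open>i < n\<close>, and
    \<open>n * n\<close> from the factors \<open>i > n\<close>.\<close>
  define e where "e = n + (n choose 2) + n * n"
  have two_e: "2 * int e = 3 * int n * int n + int n"
    using two_choose_two[of n] by (simp add: e_def algebra_simps)
  have "(\<Prod>i\<in>{..2 * n} - {n}. ?q ^ n - ?q ^ i)
      = (\<Prod>i<n. ?q ^ n - ?q ^ i) * (\<Prod>i=Suc n..2 * n. ?q ^ n - ?q ^ i)"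
    by (subst prod.union_disjoint[symmetric]) (auto intro!: prod.cong)
  also have "(\<Prod>i=Suc n..2 * n. ?q ^ n - ?q ^ i) = (\<Prod>i=1..n. ?q ^ n * (1 - ?q ^ i))"
    by (rule prod.reindex_bij_witness[of _ "\<lambda>i. i + n" "\<lambda>i. i - n"])
      (auto simp: algebra_simps simp flip: power_add)
  also have "\<dots> = ?q ^ (n * n) * qpoch ?q n"
    by (simp add: prod.distrib qpoch_def power_mult)
  also have "(\<Prod>i<n. ?q ^ n - ?q ^ i) = (-1) ^ n * ?q ^ (n choose 2) * qpoch ?q n"
  proof -
    have "(\<Prod>i<n. ?q ^ n - ?q ^ i) = (\<Prod>i<n. - 1 * ?q ^ i * (1 - ?q ^ (n - i)))"
      by (rule prod.cong) (auto simp: algebra_simps simp flip: power_add)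
    also have "\<dots> = (-1) ^ n * (\<Prod>i<n. ?q ^ i) * (\<Prod>i<n. 1 - ?q ^ (n - i))"
      by (simp only: prod.distrib) simp
    also have "(\<Prod>i<n. ?q ^ i) = ?q ^ (n choose 2)"
      by (induction n) (simp_all add: numeral_2_eq_2 power_add)
    also have "(\<Prod>i<n. 1 - ?q ^ (n - i)) = qpoch ?q n"
      unfolding qpoch_def
      by (rule prod.reindex_bij_witness[of _ "\<lambda>i. n - i" "\<lambda>i. n - i"]) auto
    finally show ?thesis .
  qed
  finally have lhs: "- (?q ^ n * (\<Prod>i\<in>{..2 * n} - {n}. ?q ^ n - ?q ^ i))
      = - ((-1) ^ n * ?q ^ e * qpoch ?q n ^ 2)"
    by (simp add: e_def power_add power2_eq_square ac_simps)
  define f where "f j = (-1) ^ j * of_nat j * ?q ^ ((j choose 2) + n * (2 * n + 1 - j))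
      * qbinom ?q (2 * n + 1) j" for j
  have "(\<Sum>j\<le>2 * n + 1. f j) = (\<Sum>j\<le>n. f j) + (\<Sum>j=Suc n..2 * n + 1. f j)"
    by (subst sum.union_disjoint[symmetric]) (auto intro!: sum.cong simp del: sum.atMost_Suc)
  also have "(\<Sum>j\<le>n. f j) = (\<Sum>k\<le>n. f (n - k))"
    by (rule sum.reindex_bij_witness[of _ "\<lambda>i. n - i" "\<lambda>i. n - i"]) auto
  also have "(\<Sum>j=Suc n..2 * n + 1. f j) = (\<Sum>k\<le>n. f (n + 1 + k))"
    by (rule sum.reindex_bij_witness[of _ "\<lambda>i. n + 1 + i" "\<lambda>i. i - (n + 1)"]) auto
  finally have "(\<Sum>j\<le>2 * n + 1. f j) = (\<Sum>k\<le>n. f (n - k) + f (n + 1 + k))"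
    by (simp only: sum.distrib)
  also have "\<dots> = (\<Sum>k\<le>n. - ((-1) ^ n * ?q ^ e) * ((-1) ^ k * of_nat (2 * k + 1) * ?q ^ triangle k
      * qbinom ?q (2 * n + 1) (n - k)))"
  proof (rule sum.cong)
    fix k assume "k \<in> {..n}"
    then obtain l where l: "n = k + l" by (auto simp: le_iff_add)
    have "((n - k) choose 2) + n * (2 * n + 1 - (n - k)) = e + triangle k"
      using two_choose_two[of l] two_e two_triangle[of k]
      by (subst of_nat_eq_iff[where 'a = int, symmetric]) (simp add: l algebra_simps)
    moreover have "((n + 1 + k) choose 2) + n * (2 * n + 1 - (n + 1 + k)) = e + triangle k"
      using two_choose_two[of "n + 1 + k"] two_e two_triangle[of k]
      by (subst of_nat_eq_iff[where 'a = int, symmetric]) (simp add: l algebra_simps)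
    moreover have "qbinom ?q (2 * n + 1) (n + 1 + k) = qbinom ?q (2 * n + 1) (n - k)"
    proof -
      have *: "n + 1 + k = 2 * n + 1 - (n - k)" using l by simp
      show ?thesis unfolding * by (rule qbinom_symmetric) simp
    qed
    moreover have "(-1 :: 'a fps) ^ (n - k) = (-1) ^ n * (-1) ^ k"
      by (simp add: l minus_one_power_iff)
    moreover have "(-1 :: 'a fps) ^ (n + 1 + k) = - ((-1) ^ n * (-1) ^ k)"
      by (simp add: power_add)
    ultimately have "f (n - k) + f (n + 1 + k) = (-1) ^ n * (-1) ^ k * ?q ^ (e + triangle k)
        * qbinom ?q (2 * n + 1) (n - k) * (of_nat (n - k) - of_nat (n + 1 + k))"
      unfolding f_def by (simp only:) (simp add: algebra_simps del: qbinom.simps)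
    also have "of_nat (n - k) - of_nat (n + 1 + k) = (- of_nat (2 * k + 1) :: 'a fps)"
      by (simp add: l)
    finally show "f (n - k) + f (n + 1 + k) = - ((-1) ^ n * ?q ^ e) * ((-1) ^ k * of_nat (2 * k + 1)
        * ?q ^ triangle k * qbinom ?q (2 * n + 1) (n - k))"
      by (simp only: power_add) (simp only: ac_simps mult_minus_left mult_minus_right)
  qed simp
  finally have "- ((-1) ^ n * ?q ^ e * qpoch ?q n ^ 2) = - ((-1) ^ n * ?q ^ e)
      * (\<Sum>k\<le>n. (-1) ^ k * of_nat (2 * k + 1) * ?q ^ triangle k * qbinom ?q (2 * n + 1) (n - k))"
    using jacobi_finite_aux[of ?q n] lhs by (simp only: f_def sum_distrib_left)
  then show ?thesis by (simp add: mult.assoc del: qbinom.simps)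
qed

text \<open>Multiplied by the Euler product, the Gaussian binomial in summand \<open>k\<close> is 1
  modulo \<open>fps_X ^ Suc (n - k)\<close>. The factor \<open>fps_X ^ triangle k\<close>, with
  \<open>triangle k \<ge> k\<close>, supplies the missing order.\<close>

theorem euler_fps_cube_cong:
  "fps_X ^ Suc n dvd (euler_fps ^ 3 - jacobi_sum fps_X n :: 'a::idom fps)"
proof -
  let ?q = "fps_X :: 'a fps"
  have euler_mult_partitions: "euler_fps * Abs_fps (\<lambda>n. of_nat (num_partitions n)) = (1 :: 'a fps)"
    by (subst mult.commute) (rule partitions_gf)
  let ?c = "\<lambda>k. (-1) ^ k * of_nat (2 * k + 1) * ?q ^ triangle k"
  have "?q ^ Suc n dvd ?c k * (qbinom ?q (2 * n + 1) (n - k) * euler_fps - 1)" if "k \<le> n" for k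
  proof -
    let ?B = "qbinom ?q (2 * n + 1) (n - k)"
    define m where "m = Suc (n - k)"
    have cong: "?q ^ m dvd qpoch ?q i - euler_fps" if "m \<le> Suc i" for i
      using dvd_diff_swap[OF euler_fps_cong'[OF that]] .
    have "?B * qpoch ?q (n - k) * qpoch ?q (n + 1 + k) = qpoch ?q (2 * n + 1)"
      using qbinom_qpoch[of "n - k" "2 * n + 1" ?q] that by simp
    moreover have "?q ^ m dvd ?B * qpoch ?q (n - k) * qpoch ?q (n + 1 + k) - ?B * euler_fps * euler_fps"
      by (intro dvd_diff_mult cong) (simp_all add: m_def)
    moreover have "?q ^ m dvd qpoch ?q (2 * n + 1) - euler_fps"
      by (rule cong) (simp add: m_def)
    ultimately have "?q ^ m dvd ?B * euler_fps * euler_fps - euler_fps"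
      using dvd_diff[of "?q ^ m"] by fastforce
    then have "?q ^ m dvd (?B * euler_fps - 1) * euler_fps"
      by (simp add: algebra_simps)
    \<comment> \<open>The partition series is the inverse of \<open>euler_fps\<close>, so this
      factor cancels the Euler product.\<close>
    then have "?q ^ m dvd (?B * euler_fps - 1) * euler_fps * Abs_fps (\<lambda>n. of_nat (num_partitions n))"
      by (rule dvd_mult2)
    then have "?q ^ m dvd ?B * euler_fps - 1"
      by (simp only: mult.assoc euler_mult_partitions mult_1_right)
    then have "?q ^ (triangle k + m) dvd ?q ^ triangle k * (?B * euler_fps - 1)"
      by (simp add: power_add mult_dvd_mono)
    moreover have "k \<le> triangle k" by (induction k) auto
    then have "Suc n \<le> triangle k + m" using that by (simp add: m_def)
    ultimately have "?q ^ Suc n dvd ?q ^ triangle k * (?B * euler_fps - 1)"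
      by (rule power_le_dvd)
    then show ?thesis by (simp only: mult.assoc dvd_mult)
  qed
  then have "?q ^ Suc n dvd (\<Sum>k\<le>n. ?c k * (qbinom ?q (2 * n + 1) (n - k) * euler_fps - 1))"
    by (intro dvd_sum) simp
  also have "\<dots> = qpoch ?q n ^ 2 * euler_fps - jacobi_sum ?q n"
    unfolding jacobi_finite jacobi_sum_def sum_distrib_right sum_subtractf[symmetric]
    by (rule sum.cong) (simp_all only: right_diff_distrib mult.assoc mult_1_right)
  finally have "?q ^ Suc n dvd qpoch ?q n ^ 2 * euler_fps - jacobi_sum ?q n" .
  moreover have "?q ^ Suc n dvd euler_fps ^ 2 * euler_fps - qpoch ?q n ^ 2 * euler_fps"
    by (intro dvd_diff_mult dvd_diff_power euler_fps_cong) simp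
  ultimately have "?q ^ Suc n dvd euler_fps ^ 2 * euler_fps - jacobi_sum ?q n"
    using dvd_diff_trans by blast
  then show ?thesis by (simp add: power3_eq_cube power2_eq_square)
qed

subsection \<open>Residue classes of exponents modulo 7\<close>

definition residue7 :: "nat \<Rightarrow> 'a::zero fps \<Rightarrow> 'a fps" where
  "residue7 r f = Abs_fps (\<lambda>n. if n mod 7 = r then f $ n else 0)"

lemma residue7_nth: "residue7 r f $ n = (if n mod 7 = r then f $ n else 0)"
  by (simp add: residue7_def)

lemma residue7_add: "residue7 r (f + g) = residue7 r f + residue7 r (g :: 'a::comm_ring_1 fps)"
  by (simp add: fps_eq_iff residue7_nth)

lemma residue7_diff: "residue7 r (f - g) = residue7 r f - residue7 r (g :: 'a::comm_ring_1 fps)"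
  by (simp add: fps_eq_iff residue7_nth)

lemma residue7_minus: "residue7 r (- f) = - residue7 r (f :: 'a::comm_ring_1 fps)"
  by (simp add: fps_eq_iff residue7_nth)

lemma residue7_const_mult:
  "residue7 r (fps_const c * f) = fps_const c * residue7 r (f :: 'a::comm_ring_1 fps)"
  by (simp add: fps_eq_iff residue7_nth)

lemma residue7_numeral_mult:
  "residue7 r (numeral k * f) = numeral k * residue7 r (f :: 'a::comm_ring_1 fps)"
  by (simp add: numeral_fps_const residue7_const_mult)

lemma residue7_sum:
  "residue7 r (sum f A) = (\<Sum>i\<in>A. residue7 r (f i :: 'a::comm_ring_1 fps))"
  by (simp add: fps_eq_iff residue7_nth fps_sum_nth)

lemma residue7_const_mult_X_power:
  "residue7 r (fps_const c * fps_X ^ n) =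
     (if n mod 7 = r then fps_const c * fps_X ^ n else (0 :: 'a::comm_ring_1 fps))"
  by (auto simp: fps_eq_iff residue7_nth)

lemma fps_X_power_dvd_residue7:
  "fps_X ^ n dvd f \<Longrightarrow> fps_X ^ n dvd residue7 r (f :: 'a::comm_ring_1 fps)"
  by (simp add: fps_X_power_dvd_iff residue7_nth)

lemma sum_residue7: "(\<Sum>r<7. residue7 r f) = (f :: 'a::comm_ring_1 fps)"
  by (simp add: fps_eq_iff fps_sum_nth residue7_nth)

text \<open>The weight \<open>s\<close> counts modulo 7, so weights simply add under multiplication,
  and the zero series has every weight.\<close>

definition homogeneous7 :: "nat \<Rightarrow> 'a::zero fps \<Rightarrow> bool" where
  "homogeneous7 s f \<longleftrightarrow> (\<forall>n. f $ n \<noteq> 0 \<longrightarrow> n mod 7 = s mod 7)"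

lemma homogeneous7_residue7: "homogeneous7 r (residue7 r f)"
  by (auto simp: homogeneous7_def residue7_nth split: if_splits)

lemma residue7_homogeneous7:
  assumes "homogeneous7 s f"
  shows "residue7 r f = (if s mod 7 = r then f else 0)"
  using assms by (auto simp: fps_eq_iff residue7_nth homogeneous7_def)

lemma homogeneous7_1: "homogeneous7 0 (1 :: 'a::comm_ring_1 fps)"
  by (auto simp: homogeneous7_def)

lemma homogeneous7_mult:
  fixes f g :: "'a::comm_ring_1 fps"
  assumes "homogeneous7 s f" "homogeneous7 t g"
  shows "homogeneous7 (s + t) (f * g)"
  unfolding homogeneous7_def
proof (intro allI impI)
  fix n assume "(f * g) $ n \<noteq> 0"
  then obtain i where i: "i \<le> n" "f $ i * g $ (n - i) \<noteq> 0"
    by (auto simp: fps_mult_nth elim: sum.not_neutral_contains_not_neutral)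
  then have "f $ i \<noteq> 0" "g $ (n - i) \<noteq> 0" by auto
  then have "i mod 7 = s mod 7" "(n - i) mod 7 = t mod 7"
    using assms by (auto simp: homogeneous7_def)
  then have "(i + (n - i)) mod 7 = (s + t) mod 7" by (rule mod_add_cong)
  then show "n mod 7 = (s + t) mod 7" using i by simp
qed

lemma homogeneous7_power:
  fixes f :: "'a::comm_ring_1 fps"
  assumes "homogeneous7 s f"
  shows "homogeneous7 (n * s) (f ^ n)"
  using homogeneous7_mult[OF assms] by (induction n) (auto simp: homogeneous7_1)

text \<open>A factor of weight 0 moves none of the seven classes of \<open>f\<close>: extraction of
  a class is linear over series in \<open>fps_X ^ 7\<close>.\<close>

lemma residue7_mult_homogeneous7:
  fixes f g :: "'a::comm_ring_1 fps"
  assumes "homogeneous7 0 g"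
  shows "residue7 r (g * f) = g * residue7 r f"
proof (cases "r < 7")
  case True
  have "g * f = (\<Sum>i<7. g * residue7 i f)"
    using sum_residue7[of f] by (simp flip: sum_distrib_left)
  also have "residue7 r \<dots> = (\<Sum>i<7. if i = r then g * residue7 i f else 0)"
    using residue7_homogeneous7[OF homogeneous7_mult[OF assms homogeneous7_residue7], of r]
    by (auto simp: residue7_sum intro!: sum.cong)
  finally show ?thesis using True by simp
next
  case False
  then have "n mod 7 \<noteq> r" for n
    using mod_less_divisor[of 7 n] by linarith
  then have "residue7 r h = 0" for h :: "'a fps"
    by (simp add: fps_eq_iff residue7_nth)
  then show ?thesis by simp
qed

section \<open>Pentagonal and triangular numbers modulo 7\<close>

lemma mod_7_of_double:
  fixes p :: nat and c t :: int
  assumes "2 * int p = 7 * t + c"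
  shows "int (p mod 7) = (4 * c) mod 7"
proof -
  \<comment> \<open>4 is the inverse of 2 modulo 7.\<close>
  have "int p = 4 * c + 7 * (4 * t - int p)" using assms by simp
  then have "int p mod 7 = (4 * c) mod 7" by (metis mod_mult_self2)
  then show ?thesis by (simp add: of_nat_mod)
qed

text \<open>As 24 times \<open>pent k\<close> plus 1 is the square of \<open>6 * k - 1\<close>,
  class 2 occurs only where this square vanishes modulo 7, and classes 3, 4, 6 would make a
  nonresidue a square.\<close>

lemma pent_mod_7:
  "pent k mod 7 = (if k mod 7 = 6 then 2 else if k mod 7 \<in> {0, 5} then 0
     else if k mod 7 \<in> {1, 4} then 1 else 5)"
proof -
  define m where "m = k div 7"
  define r where "r = k mod 7"
  have k: "k = 7 * m + r" by (simp add: m_def r_def)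
  have "2 * int (pent k) = 7 * (21 * m * m + 6 * m * r - m) + r * (3 * r - 1)"
    unfolding two_pent k by (simp add: algebra_simps)
  then have p: "int (pent k mod 7) = (4 * (r * (3 * r - 1))) mod 7"
    by (rule mod_7_of_double)
  have "r \<in> {0..6}" by (auto simp: r_def)
  also have "{0..6} = {0, 1, 2, 3, 4, 5, 6 :: int}" by auto
  finally show ?thesis
    using p unfolding r_def[symmetric] by (elim insertE emptyE) simp_all
qed

text \<open>As 8 times \<open>triangle k\<close> plus 1 is the square of \<open>2 * k + 1\<close>,
  class 6 occurs only where 7 divides \<open>2 * k + 1\<close>, and classes 2, 4, 5 would make a
  nonresidue a square.\<close>

lemma triangle_mod_7:
  "triangle k mod 7 = (if k mod 7 = 3 then 6 else if k mod 7 \<in> {0, 6} then 0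
     else if k mod 7 \<in> {1, 5} then 1 else 3)"
proof -
  define m where "m = k div 7"
  define r where "r = k mod 7"
  have k: "k = 7 * m + r" by (simp add: m_def r_def)
  have "2 * int (triangle k) = 7 * (7 * int m * int m + 2 * int m * int r + int m) + int r * (int r + 1)"
    unfolding two_triangle k by (simp add: algebra_simps)
  then have p: "int (triangle k mod 7) = (4 * (int r * (int r + 1))) mod 7"
    by (rule mod_7_of_double)
  have "r \<in> {..6}" using mod_less_divisor[of 7 k] by (auto simp: r_def)
  also have "{..6} = {0, 1, 2, 3, 4, 5, 6 :: nat}" by auto
  finally show ?thesis
    using p unfolding r_def[symmetric] by (elim insertE emptyE) simp_all
qed

lemma residue7_pent_sum:
  "residue7 r (pent_sum fps_X n :: 'a::comm_ring_1 fps) =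
     (\<Sum>k | k \<in> {-int n..int n} \<and> pent k mod 7 = r. (if even k then 1 else -1) * fps_X ^ pent k)"
proof -
  have *: "(if even k then 1 else -1) = fps_const (if even k then 1 else -1 :: 'a)" for k :: int
    by simp
  have "residue7 r (pent_sum fps_X n :: 'a fps) =
      (\<Sum>k\<in>{-int n..int n}. if pent k mod 7 = r then (if even k then 1 else -1) * fps_X ^ pent k else 0)"
    unfolding pent_sum_def residue7_sum * residue7_const_mult_X_power ..
  then show ?thesis
    by (simp only: sum.inter_filter finite_atLeastAtMost_int finite_atMost)
qed

lemma residue7_jacobi_sum:
  "residue7 r (jacobi_sum fps_X n :: 'a::comm_ring_1 fps) =
     (\<Sum>k | k \<in> {..n} \<and> triangle k mod 7 = r. (-1) ^ k * of_nat (2 * k + 1) * fps_X ^ triangle k)"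
proof -
  have *: "(-1) ^ k * of_nat (2 * k + 1) = fps_const ((-1) ^ k * of_nat (2 * k + 1) :: 'a)" for k
    by (simp flip: fps_const_mult fps_const_power fps_const_neg fps_of_nat fps_const_1_eq_1)
  have "residue7 r (jacobi_sum fps_X n :: 'a fps) =
      (\<Sum>k\<le>n. if triangle k mod 7 = r then (-1) ^ k * of_nat (2 * k + 1) * fps_X ^ triangle k else 0)"
    unfolding jacobi_sum_def residue7_sum * residue7_const_mult_X_power ..
  then show ?thesis
    by (simp only: sum.inter_filter finite_atLeastAtMost_int finite_atMost)
qed

text \<open>The surviving indices are \<open>k = 7 * m - 1\<close>, with
  \<open>pent k = 2 + 49 * pent m\<close>. The sign changes because \<open>k\<close> and
  \<open>m\<close> have opposite parity.\<close>

lemma residue7_2_pent_sum: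
  "residue7 2 (pent_sum fps_X (7 * n + 1)) = - (fps_X ^ 2 * pent_sum (fps_X ^ 49) n :: 'a::comm_ring_1 fps)"
proof -
  let ?g = "\<lambda>k. (if even k then 1 else -1) * fps_X ^ pent k :: 'a fps"
  have pent: "pent (7 * m - 1) = 2 + 49 * pent m" for m
    using two_pent[of "7 * m - 1"] two_pent[of m]
    by (subst of_nat_eq_iff[where 'a = int, symmetric]) (simp add: algebra_simps)
  have "residue7 2 (pent_sum fps_X (7 * n + 1) :: 'a fps) = (\<Sum>m\<in>{-int n..int n}. ?g (7 * m - 1))"
    unfolding residue7_pent_sum
  proof (rule sum.reindex_bij_witness[of _ "\<lambda>m. 7 * m - 1" "\<lambda>k. (k + 1) div 7"])
    fix k assume "k \<in> {k. k \<in> {-int (7 * n + 1)..int (7 * n + 1)} \<and> pent k mod 7 = 2}"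
    then have k: "k mod 7 = 6" "- 7 * int n - 1 \<le> k" "k \<le> 7 * int n + 1"
      by (auto simp: pent_mod_7 split: if_splits)
    define m where "m = k div 7"
    have km: "k = 7 * m + 6" using k(1) unfolding m_def by presburger
    have div: "(k + 1) div 7 = m + 1" unfolding km by simp
    show *: "7 * ((k + 1) div 7) - 1 = k" unfolding div km by simp
    show "?g (7 * ((k + 1) div 7) - 1) = ?g k" unfolding * ..
    show "(k + 1) div 7 \<in> {-int n..int n}" using k unfolding div km by simp
  next
    fix m assume "m \<in> {-int n..int n}"
    moreover have "(7 * m - 1) mod 7 = 6" by presburger
    ultimately show "7 * m - 1 \<in> {k. k \<in> {-int (7 * n + 1)..int (7 * n + 1)} \<and> pent k mod 7 = 2}"
      by (simp add: pent_mod_7)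
  qed auto
  also have "\<dots> = - (fps_X ^ 2 * pent_sum (fps_X ^ 49) n)"
    unfolding pent_sum_def sum_distrib_left sum_negf[symmetric]
    unfolding pent power_add power_mult by (rule sum.cong) auto
  finally show ?thesis .
qed

text \<open>The surviving indices are \<open>k = 7 * m + 3\<close>. Their coefficients
  \<open>2 * k + 1 = 7 * (2 * m + 1)\<close> produce the factor 7, and the change of parity the
  sign.\<close>

lemma residue7_6_jacobi_sum:
  "residue7 6 (jacobi_sum fps_X (7 * n + 3)) =
     - (7 * fps_X ^ 6 * jacobi_sum (fps_X ^ 49) n :: 'a::comm_ring_1 fps)"
proof -
  let ?g = "\<lambda>k. (-1) ^ k * of_nat (2 * k + 1) * fps_X ^ triangle k :: 'a fps"
  have triangle: "triangle (7 * m + 3) = 6 + 49 * triangle m" for m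
    using two_triangle[of "7 * m + 3"] two_triangle[of m]
    by (subst of_nat_eq_iff[where 'a = int, symmetric]) (simp add: algebra_simps)
  have "residue7 6 (jacobi_sum fps_X (7 * n + 3) :: 'a fps) = (\<Sum>m\<le>n. ?g (7 * m + 3))"
    unfolding residue7_jacobi_sum
  proof (rule sum.reindex_bij_witness[of _ "\<lambda>m. 7 * m + 3" "\<lambda>k. k div 7"])
    fix k assume "k \<in> {k. k \<in> {..7 * n + 3} \<and> triangle k mod 7 = 6}"
    then have k: "k mod 7 = 3" "k \<le> 7 * n + 3"
      by (auto simp: triangle_mod_7 split: if_splits)
    then show "7 * (k div 7) + 3 = k" by presburger
    then show "?g (7 * (k div 7) + 3) = ?g k" by simp
    show "k div 7 \<in> {..n}" using k by simp
  qed (auto simp: triangle_mod_7)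
  also have "\<dots> = - (7 * fps_X ^ 6 * jacobi_sum (fps_X ^ 49) n)"
    unfolding jacobi_sum_def sum_distrib_left sum_negf[symmetric]
    unfolding triangle power_add power_mult
    by (rule sum.cong) (auto simp: minus_one_power_iff algebra_simps)
  finally show ?thesis .
qed

section \<open>Residue classes of the Euler product and of its cube\<close>

lemma pent_sum_compose:
  fixes u :: "'a::idom fps"
  assumes "u $ 0 = 0"
  shows "pent_sum fps_X n oo u = pent_sum u n"
  using assms
  by (auto simp: pent_sum_def fps_compose_sum_distrib fps_compose_mult_distrib fps_compose_uminus
      fps_compose_power[symmetric] fps_X_fps_compose_startby0 intro!: sum.cong)

lemma jacobi_sum_compose:
  fixes u :: "'a::idom fps"
  assumes "u $ 0 = 0"
  shows "jacobi_sum fps_X n oo u = jacobi_sum u n"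
proof -
  have *: "(-1) ^ k * of_nat (2 * k + 1) = fps_const ((-1) ^ k * of_nat (2 * k + 1) :: 'a)" for k
    by (simp flip: fps_const_mult fps_const_power fps_const_neg fps_of_nat fps_const_1_eq_1)
  show ?thesis
    unfolding jacobi_sum_def fps_compose_sum_distrib *
    using assms by (simp only: fps_compose_mult_distrib fps_const_compose fps_compose_power[symmetric]
        fps_X_fps_compose_startby0)
qed

theorem residue7_2_euler_fps:
  "residue7 2 euler_fps = - (fps_X ^ 2 * (euler_fps oo fps_X ^ 49) :: 'a::idom fps)"
proof (rule fps_eqI_dvd)
  fix n
  let ?p = "pent_sum fps_X (7 * n + 1) :: 'a fps"
  have "fps_X ^ n dvd euler_fps - ?p"
    by (rule power_le_dvd[OF euler_fps_cong_pent_sum]) simp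
  then have 1: "fps_X ^ n dvd residue7 2 euler_fps - residue7 2 ?p"
    by (simp add: fps_X_power_dvd_residue7 flip: residue7_diff)
  have "fps_X ^ n dvd (euler_fps - pent_sum fps_X n :: 'a fps)"
    by (rule power_le_dvd[OF euler_fps_cong_pent_sum]) simp
  then have "fps_X ^ n dvd (euler_fps - pent_sum fps_X n :: 'a fps) oo fps_X ^ 49"
    by (rule fps_X_power_dvd_compose[rotated]) simp
  then have "fps_X ^ n dvd pent_sum (fps_X ^ 49) n - (euler_fps oo fps_X ^ 49 :: 'a fps)"
    by - (rule dvd_diff_swap, simp add: fps_compose_sub_distrib pent_sum_compose)
  then have "fps_X ^ n dvd - (fps_X ^ 2) * pent_sum (fps_X ^ 49) n
      - (- (fps_X ^ 2) * (euler_fps oo fps_X ^ 49 :: 'a fps))"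
    by (intro dvd_diff_mult) simp_all
  with 1 show "fps_X ^ n dvd residue7 2 euler_fps - - (fps_X ^ 2 * (euler_fps oo fps_X ^ 49) :: 'a fps)"
    unfolding residue7_2_pent_sum mult_minus_left by (rule dvd_diff_trans)
qed

theorem residue7_euler_fps_eq_0:
  assumes "r \<in> {3, 4, 6}"
  shows "residue7 r euler_fps = (0 :: 'a::idom fps)"
proof (rule fps_eqI_dvd)
  fix n
  have "fps_X ^ n dvd (euler_fps - pent_sum fps_X n :: 'a fps)"
    by (rule power_le_dvd[OF euler_fps_cong_pent_sum]) simp
  then have "fps_X ^ n dvd residue7 r (euler_fps :: 'a fps) - residue7 r (pent_sum fps_X n)"
    by (simp add: fps_X_power_dvd_residue7 flip: residue7_diff)
  moreover have "residue7 r (pent_sum fps_X n) = (0 :: 'a fps)"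
    unfolding residue7_pent_sum using assms
    by (intro sum.neutral) (auto simp: pent_mod_7 split: if_splits)
  ultimately show "fps_X ^ n dvd residue7 r (euler_fps :: 'a fps) - 0" by simp
qed

theorem residue7_6_euler_fps_cube:
  "residue7 6 (euler_fps ^ 3) = - (7 * fps_X ^ 6 * (euler_fps oo fps_X ^ 49) ^ 3 :: 'a::idom fps)"
proof (rule fps_eqI_dvd)
  fix n
  let ?p = "jacobi_sum fps_X (7 * n + 3) :: 'a fps"
  have "fps_X ^ n dvd euler_fps ^ 3 - ?p"
    by (rule power_le_dvd[OF euler_fps_cube_cong]) simp
  then have 1: "fps_X ^ n dvd residue7 6 (euler_fps ^ 3) - residue7 6 ?p"
    by (simp add: fps_X_power_dvd_residue7 flip: residue7_diff)
  have "fps_X ^ n dvd (euler_fps ^ 3 - jacobi_sum fps_X n :: 'a fps)"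
    by (rule power_le_dvd[OF euler_fps_cube_cong]) simp
  then have "fps_X ^ n dvd (euler_fps ^ 3 - jacobi_sum fps_X n :: 'a fps) oo fps_X ^ 49"
    by (rule fps_X_power_dvd_compose[rotated]) simp
  then have "fps_X ^ n dvd jacobi_sum (fps_X ^ 49) n - ((euler_fps oo fps_X ^ 49) ^ 3 :: 'a fps)"
    by - (rule dvd_diff_swap, simp add: fps_compose_sub_distrib jacobi_sum_compose fps_compose_power)
  then have "fps_X ^ n dvd - (7 * fps_X ^ 6) * jacobi_sum (fps_X ^ 49) n
      - (- (7 * fps_X ^ 6) * ((euler_fps oo fps_X ^ 49) ^ 3 :: 'a fps))"
    by (intro dvd_diff_mult) simp_all
  with 1 show "fps_X ^ n dvd residue7 6 (euler_fps ^ 3)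
      - - (7 * fps_X ^ 6 * (euler_fps oo fps_X ^ 49) ^ 3 :: 'a fps)"
    unfolding residue7_6_jacobi_sum mult_minus_left by (rule dvd_diff_trans)
qed

theorem residue7_euler_fps_cube_eq_0:
  assumes "r \<in> {2, 4, 5}"
  shows "residue7 r (euler_fps ^ 3) = (0 :: 'a::idom fps)"
proof (rule fps_eqI_dvd)
  fix n
  have "fps_X ^ n dvd (euler_fps ^ 3 - jacobi_sum fps_X n :: 'a fps)"
    by (rule power_le_dvd[OF euler_fps_cube_cong]) simp
  then have "fps_X ^ n dvd residue7 r (euler_fps ^ 3 :: 'a fps) - residue7 r (jacobi_sum fps_X n)"
    by (simp add: fps_X_power_dvd_residue7 flip: residue7_diff)
  moreover have "residue7 r (jacobi_sum fps_X n) = (0 :: 'a fps)"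
    unfolding residue7_jacobi_sum using assms
    by (intro sum.neutral) (auto simp: triangle_mod_7 split: if_splits)
  ultimately show "fps_X ^ n dvd residue7 r (euler_fps ^ 3 :: 'a fps) - 0" by simp
qed

subsection \<open>The norm form\<close>

text \<open>\<open>norm_u\<close> and \<open>norm_v\<close> are the coordinates of half of the norm
  with respect to 1 and the Gaussian period \<open>w + w^2 + w^4\<close>; see
  \<open>half_norm\<close>.\<close>

definition norm_u :: "'a::comm_ring_1 \<Rightarrow> 'a \<Rightarrow> 'a \<Rightarrow> 'a \<Rightarrow> 'a" where
  "norm_u a b c d = a^3 - a^2*c - a*b^2 + 3*a*b*c - a*b*d - a*c*d - a*d^2 + b^3 - b*c^2 - b*c*d - b*d^2 + c^3 - c*d^2 + d^3"

definition norm_v :: "'a::comm_ring_1 \<Rightarrow> 'a \<Rightarrow> 'a \<Rightarrow> 'a \<Rightarrow> 'a" where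
  "norm_v a b c d = a^2*b - a^2*c + a^2*d - a*b^2 + a*b*c + a*c^2 - a*d^2 + b^2*c + b^2*d - b*c^2 - b*d^2 + c^2*d - c*d^2"

text \<open>The product of the two conjugates of \<open>norm_u + eta * norm_v\<close>, where
  \<open>eta = w + w^2 + w^4\<close>: the two periods have sum -1 and product 2.\<close>

definition norm_cofactor :: "'a::comm_ring_1 \<Rightarrow> 'a \<Rightarrow> 'a \<Rightarrow> 'a \<Rightarrow> 'a" where
  "norm_cofactor a b c d =
     norm_u a b c d ^ 2 - norm_u a b c d * norm_v a b c d + 2 * norm_v a b c d ^ 2"

lemma half_norm:
  fixes w a b c d :: "'a::idom"
  assumes "1 + w + w^2 + w^3 + w^4 + w^5 + w^6 = 0"
  defines "F \<equiv> \<lambda>x. a + x * b + x^5 * c + x^2 * d"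
  shows "F w * F (w^2) * F (w^4) = norm_u a b c d + (w + w^2 + w^4) * norm_v a b c d"
proof -
  have "(w - 1) * (1 + w + w^2 + w^3 + w^4 + w^5 + w^6) = w ^ 7 - 1" by algebra
  then have w7: "w ^ 7 = 1" using assms by simp
  have "w ^ 10 = w^3" using w7 by algebra
  moreover have "w ^ 20 = w^6" using w7 by algebra
  moreover have "w ^ 8 = w" using w7 by algebra
  ultimately have "(w^2)^5 = w^3" "(w^2)^2 = w^4" "(w^4)^5 = w^6" "(w^4)^2 = w"
    by (simp_all flip: power_mult)
  then have "F w * F (w^2) * F (w^4) = (a + w * b + w^5 * c + w^2 * d)
      * (a + w^2 * b + w^3 * c + w^4 * d) * (a + w^4 * b + w^6 * c + w * d)"
    by (simp only: F_def)
  also have "\<dots> = norm_u a b c d + (w + w^2 + w^4) * norm_v a b c d"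
    using assms(1) unfolding norm_u_def norm_v_def by algebra
  finally show ?thesis .
qed

text \<open>The exponents 1, 2, 4 and 3, 6, 5 are the cosets of the squares modulo 7, so the two half
  products are conjugate over the quadratic field generated by \<open>w + w\<^sup>2 + w\<^sup>4\<close>.\<close>

lemma prod_norm_cofactor:
  fixes w :: "'a::idom"
  assumes w: "1 + w + w^2 + w^3 + w^4 + w^5 + w^6 = 0"
  shows "(\<Prod>k=1..6. a + w^k * b + (w^k)^5 * c + (w^k)^2 * d) = norm_cofactor a b c d"
proof -
  define F where "F = (\<lambda>x. a + x * b + x^5 * c + x^2 * d)"
  have "(w - 1) * (1 + w + w^2 + w^3 + w^4 + w^5 + w^6) = w ^ 7 - 1" by algebra
  then have w7: "w ^ 7 = 1" using w by simp
  \<comment> \<open>3 is not a square modulo 7, so \<open>half_norm\<close> applied to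
    \<open>w^3\<close> covers the other coset of exponents, 3, 6 and 5.\<close>
  have w3: "1 + w^3 + (w^3)^2 + (w^3)^3 + (w^3)^4 + (w^3)^5 + (w^3)^6 = 0"
    using w by algebra
  have "w ^ 12 = w^5" using w7 by algebra
  then have pow: "(w^3)^2 = w^6" "(w^3)^4 = w^5"
    by (simp_all flip: power_mult)
  have "{1..6} = {1, 2, 4, 3, 6, 5 :: nat}" by auto
  then have "(\<Prod>k=1..6. F (w^k)) = (F w * F (w^2) * F (w^4)) * (F (w^3) * F (w^6) * F (w^5))"
    by (simp add: mult.assoc)
  also have "\<dots> = (norm_u a b c d + (w + w^2 + w^4) * norm_v a b c d)
      * (norm_u a b c d + (w^3 + w^6 + w^5) * norm_v a b c d)"
    using half_norm[OF w, of a b c d] half_norm[OF w3, of a b c d] unfolding pow F_def by simp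
  also have "\<dots> = norm_cofactor a b c d"
    unfolding norm_cofactor_def using w by algebra
  finally show ?thesis unfolding F_def .
qed

text \<open>A consequence of the four relations, found by Groebner bases. For weights 0, 1, 5, 2 of
  \<open>a\<close>, \<open>b\<close>, \<open>c\<close>, \<open>d\<close>, every term of the squared
  quartic has weight 1 modulo 7; its first three terms form Klein's quartic.\<close>

lemma norm_eq_square:
  fixes a b c d :: "'a::idom"
  assumes "a * b * c = d^3" "a^2 * d + a * b^2 + c * d^2 = 0"
    "b^2 * d + a * d^2 + b * c^2 = 0" "a^2 * c + b * d^2 + c^2 * d = 0"
  shows "d * ((a + b + c + d) * norm_cofactor a b c d)
     = -((a^3 * b + b^3 * c + c^3 * a + 8 * d^4)^2)"
  using assms unfolding norm_cofactor_def norm_u_def norm_v_def by algebra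

text \<open>The norm form at \<open>a = 1\<close>, \<open>b = -y\<close>, \<open>c = d = 0\<close>,
  together with the factor for \<open>k = 0\<close>.\<close>

lemma prod_one_minus_root:
  fixes w y :: "'a::idom"
  assumes "1 + w + w^2 + w^3 + w^4 + w^5 + w^6 = 0"
  shows "(\<Prod>k<7. 1 - w^k * y) = 1 - y ^ 7"
proof -
  have "{..<7} = insert 0 {1..6 :: nat}" by auto
  then have "(\<Prod>k<7. 1 - w^k * y) = (1 - y) * (\<Prod>k=1..6. 1 + w^k * (-y) + (w^k)^5 * 0 + (w^k)^2 * 0)"
    by simp
  also have "\<dots> = (1 - y) * ((1 - y^2 - y^3)^2 - (1 - y^2 - y^3) * (- y - y^2) + 2 * (- y - y^2)^2)"
    unfolding prod_norm_cofactor[OF assms] norm_cofactor_def norm_u_def norm_v_def by simp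
  also have "\<dots> = 1 - y ^ 7" by algebra
  finally show ?thesis .
qed

section \<open>Weights of polynomials in the four parts\<close>

context
  fixes a b c d :: "'a::{idom,ring_char_0} fps"
  assumes homogeneous: "homogeneous7 0 a" "homogeneous7 1 b" "homogeneous7 5 c" "homogeneous7 2 d"
begin

text \<open>Naming the monomials keeps them intact, so that \<open>residue7\<close> can be evaluated
  term by term from the weight \<open>j + 5 * k + 2 * l\<close>.\<close>

definition monomial :: "nat \<Rightarrow> nat \<Rightarrow> nat \<Rightarrow> nat \<Rightarrow> 'a fps" where
  "monomial i j k l = a ^ i * b ^ j * c ^ k * d ^ l"

lemma residue7_monomial:
  "residue7 r (monomial i j k l) = (if (j + 5 * k + 2 * l) mod 7 = r then monomial i j k l else 0)"
proof -
  have "homogeneous7 (i * 0 + j * 1 + k * 5 + l * 2) (monomial i j k l)"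
    unfolding monomial_def by (intro homogeneous7_mult homogeneous7_power homogeneous)
  then show ?thesis by (simp add: residue7_homogeneous7 ac_simps)
qed

lemmas residue7_polynomial =
  residue7_add residue7_diff residue7_minus residue7_numeral_mult residue7_monomial

text \<open>The terms are listed by weight modulo 7, from 0 to 6.\<close>

lemma cube_expansion:
  "(a + b + c + d) ^ 3 = monomial 3 0 0 0 + 6 * monomial 1 0 1 1 + 3 * monomial 0 2 1 0
     + 3 * monomial 2 1 0 0 + 6 * monomial 0 1 1 1 + monomial 0 0 3 0
     + 3 * monomial 2 0 0 1 + 3 * monomial 1 2 0 0 + 3 * monomial 0 0 1 2
     + 6 * monomial 1 1 0 1 + 3 * monomial 1 0 2 0 + monomial 0 3 0 0
     + 3 * monomial 1 0 0 2 + 3 * monomial 0 2 0 1 + 3 * monomial 0 1 2 0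
     + 3 * monomial 2 0 1 0 + 3 * monomial 0 1 0 2 + 3 * monomial 0 0 2 1
     + 6 * monomial 1 1 1 0 + monomial 0 0 0 3"
  unfolding monomial_def power_0 mult_1_right mult_1_left power_one_right by algebra

lemma residue7_cube:
  "residue7 2 ((a + b + c + d) ^ 3) = 3 * (a^2 * d + a * b^2 + c * d^2)"
  "residue7 4 ((a + b + c + d) ^ 3) = 3 * (b^2 * d + a * d^2 + b * c^2)"
  "residue7 5 ((a + b + c + d) ^ 3) = 3 * (a^2 * c + b * d^2 + c^2 * d)"
  "residue7 6 ((a + b + c + d) ^ 3) = 6 * (a * b * c) + d^3"
  unfolding cube_expansion residue7_polynomial by (simp_all add: monomial_def algebra_simps)

lemma norm_cofactor_expansion:
  "norm_cofactor a b c d = - monomial 0 0 3 3 + 2 * monomial 0 1 1 4 + monomial 0 4 2 0 - monomial 0 5 0 1 + 2 *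
     monomial 1 1 4 0 - 2 * monomial 1 2 2 1 + 4 * monomial 1 3 0 2 + 6 * monomial 2 0 2 2 - 3
     * monomial 2 1 0 3 + 4 * monomial 3 2 1 0 - 5 * monomial 4 0 1 1 + monomial 6 0 0 0 -
     monomial 0 0 1 5 + monomial 0 2 4 0 - 3 * monomial 0 3 2 1 + monomial 0 4 0 2 + 2 *
     monomial 1 0 4 1 - 2 * monomial 1 1 2 2 - 3 * monomial 1 2 0 3 + monomial 2 0 0 4 - 3 *
     monomial 2 3 1 0 - monomial 3 0 3 0 + monomial 3 1 1 1 - monomial 5 1 0 0 + monomial 0 0 6
     0 - 5 * monomial 0 1 4 1 + 6 * monomial 0 2 2 2 - monomial 0 3 0 3 - 3 * monomial 1 0 2 3
     + 2 * monomial 1 1 0 4 + 2 * monomial 1 4 1 0 + 4 * monomial 2 1 3 0 - 2 * monomial 2 2 1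
     1 + 4 * monomial 3 0 1 2 + monomial 4 2 0 0 - monomial 5 0 0 1 + monomial 0 0 4 2 - 3 *
     monomial 0 1 2 3 + monomial 0 2 0 4 - monomial 0 5 1 0 - monomial 1 0 0 5 - 3 * monomial 1
     2 3 0 + monomial 1 3 1 1 - 3 * monomial 2 0 3 1 - 2 * monomial 2 1 1 2 - monomial 3 3 0 0
     + monomial 4 0 2 0 + 2 * monomial 4 1 0 1 + monomial 0 0 2 4 - monomial 0 1 0 5 - monomial
     0 3 3 0 + 2 * monomial 0 4 1 1 - monomial 1 0 5 0 + monomial 1 1 3 1 - 2 * monomial 1 2 1
     2 - 3 * monomial 2 0 1 3 + monomial 2 4 0 0 - 3 * monomial 3 1 2 0 - 3 * monomial 3 2 0 1
     + monomial 4 0 0 2 + monomial 0 0 0 6 - monomial 0 1 5 0 + 4 * monomial 0 2 3 1 - 3 *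
     monomial 0 3 1 2 - 3 * monomial 1 0 3 2 + 8 * monomial 1 1 1 3 - monomial 1 5 0 0 -
     monomial 2 2 2 0 + 4 * monomial 2 3 0 1 + 4 * monomial 3 0 2 1 - 3 * monomial 3 1 0 2 -
     monomial 5 0 1 0 - monomial 0 0 5 1 + 4 * monomial 0 1 3 2 - 3 * monomial 0 2 1 3 +
     monomial 0 6 0 0 + 2 * monomial 1 0 1 4 + 4 * monomial 1 3 2 0 - 5 * monomial 1 4 0 1 +
     monomial 2 0 4 0 - 2 * monomial 2 1 2 1 + 6 * monomial 2 2 0 2 - monomial 3 0 0 3 + 2 *
     monomial 4 1 1 0"
  unfolding norm_cofactor_def norm_u_def norm_v_def monomial_def
    power_0 mult_1_right mult_1_left power_one_right by algebra

text \<open>Twelve monomials of the expansion have weight 5; the four relations reduce their sum to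
  \<open>d\<close> and the quartic whose square appears in \<open>norm_eq_square\<close>.\<close>

lemma residue7_norm_cofactor:
  assumes "a * b * c = d^3" "a^2 * d + a * b^2 + c * d^2 = 0"
    "b^2 * d + a * d^2 + b * c^2 = 0" "a^2 * c + b * d^2 + c^2 * d = 0"
  shows "residue7 5 (norm_cofactor a b c d)
     = 49 * d^6 - 7 * d^2 * (a^3 * b + b^3 * c + c^3 * a + 8 * d^4)"
proof -
  have "residue7 5 (norm_cofactor a b c d) = monomial 0 0 0 6 - monomial 0 1 5 0 + 4 * monomial 0 2 3 1 - 3 * monomial 0 3 1 2 - 3 *
     monomial 1 0 3 2 + 8 * monomial 1 1 1 3 - monomial 1 5 0 0 - monomial 2 2 2 0 + 4 *
     monomial 2 3 0 1 + 4 * monomial 3 0 2 1 - 3 * monomial 3 1 0 2 - monomial 5 0 1 0"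
    unfolding norm_cofactor_expansion residue7_polynomial by simp
  also have "\<dots> = 49 * d^6 - 7 * d^2 * (a^3 * b + b^3 * c + c^3 * a + 8 * d^4)"
    unfolding monomial_def power_0 mult_1_right mult_1_left power_one_right
    using assms by algebra
  finally show ?thesis .
qed

end

subsection \<open>Ramanujan's identity\<close>

lemma ex_root_of_unity_7: "\<exists>\<zeta>::complex. \<zeta> ^ 7 = 1 \<and> \<zeta> \<noteq> 1"
proof (rule ccontr)
  assume "\<not> ?thesis"
  then have "{z::complex. z ^ 7 = 1} \<subseteq> {1}" by auto
  then have "card {z::complex. z ^ 7 = 1} \<le> 1"
    using card_mono[of "{1::complex}"] by fastforce
  then show False by (simp add: card_roots_unity_eq)
qed

text \<open>By Bezout, some power of \<open>\<zeta> ^ i\<close> equals \<open>\<zeta>\<close>, so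
  \<open>\<zeta> ^ i\<close> is not 1 and the geometric sum vanishes.\<close>

lemma root_of_unity_7_sum:
  fixes \<zeta> :: complex
  assumes "\<zeta> ^ 7 = 1" "\<zeta> \<noteq> 1" "\<not> 7 dvd i"
  shows "1 + \<zeta> ^ i + (\<zeta> ^ i)^2 + (\<zeta> ^ i)^3 + (\<zeta> ^ i)^4 + (\<zeta> ^ i)^5 + (\<zeta> ^ i)^6 = 0"
proof -
  define x where "x = \<zeta> ^ i"
  have "x ^ 7 = (\<zeta> ^ 7) ^ i"
    by (simp add: x_def mult.commute flip: power_mult)
  then have x7: "x ^ 7 = 1" using assms(1) by simp
  have "prime (7::nat)" by simp
  then have "coprime 7 i" using assms(3) by (rule prime_imp_coprime)
  then have "coprime i 7" by (simp only: coprime_commute)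
  moreover have "i \<noteq> 0" using assms(3) by (intro notI) simp
  ultimately obtain j k where jk: "i * j = 7 * k + 1"
    using bezout_nat[of i 7] by auto
  have "x \<noteq> 1"
  proof
    assume "x = 1"
    then have "\<zeta> ^ (i * j) = 1" by (simp add: x_def power_mult)
    then show False using assms(1,2) by (simp add: jk power_add power_mult)
  qed
  moreover have "(x - 1) * (1 + x + x^2 + x^3 + x^4 + x^5 + x^6) = x ^ 7 - 1" by algebra
  ultimately show ?thesis using x7 by (simp flip: x_def)
qed

lemma fps_compose_root_homogeneous7:
  fixes f :: "complex fps"
  assumes "\<zeta> ^ 7 = 1" "homogeneous7 s f"
  shows "f oo (fps_const \<zeta> * fps_X) = fps_const (\<zeta> ^ s) * f"
proof (rule fps_ext)
  fix n
  have "\<zeta> ^ k = \<zeta> ^ (k mod 7)" for k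
    using power_add[of \<zeta> "7 * (k div 7)" "k mod 7"] assms(1) by (simp add: power_mult)
  then have "f $ n \<noteq> 0 \<Longrightarrow> \<zeta> ^ n = \<zeta> ^ s"
    using assms(2) unfolding homogeneous7_def by metis
  then show "(f oo (fps_const \<zeta> * fps_X)) $ n = (fps_const (\<zeta> ^ s) * f) $ n"
    by auto
qed

lemma prod_multiples_7:
  fixes h :: "nat \<Rightarrow> 'a::comm_monoid_mult"
  shows "(\<Prod>i=1..7 * n. if 7 dvd i then h i else 1) = (\<Prod>i=1..n. h (7 * i))"
proof -
  have "(\<Prod>i=1..7 * n. if 7 dvd i then h i else 1) = (\<Prod>i | i \<in> {1..7 * n} \<and> 7 dvd i. h i)"
    by (rule prod.inter_filter[symmetric]) simp
  also have "\<dots> = (\<Prod>i=1..n. h (7 * i))"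
    by (rule prod.reindex_bij_witness[of _ "\<lambda>i. 7 * i" "\<lambda>i. i div 7"]) auto
  finally show ?thesis .
qed

text \<open>For fixed \<open>i\<close> the seven factors multiply to \<open>(1 - q ^ i) ^ 7\<close>
  if 7 divides \<open>i\<close>, and to \<open>1 - q ^ (7 * i)\<close> otherwise. At length
  \<open>7 * n\<close> the multiples of 7 are exactly \<open>7 * 1\<close> to \<open>7 * n\<close>,
  so the truncated identity is exact.\<close>

lemma prod_qpoch_roots:
  fixes \<zeta> :: complex
  assumes "\<zeta> ^ 7 = 1" "\<zeta> \<noteq> 1"
  defines "q \<equiv> fps_X :: complex fps"
  shows "(\<Prod>k<7. qpoch (fps_const (\<zeta> ^ k) * q) (7 * n)) * qpoch (q ^ 49) n
    = qpoch (q ^ 7) (7 * n) * qpoch (q ^ 7) n ^ 7"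
proof -
  define w where "w = fps_const \<zeta>"
  have factor: "(\<Prod>k<7. 1 - (w ^ k * q) ^ i) * (if 7 dvd i then 1 - q ^ (7 * i) else 1)
      = (1 - q ^ (7 * i)) * (if 7 dvd i then (1 - q ^ i) ^ 7 else 1)" for i
  proof (cases "7 dvd i")
    case True
    have "w ^ 7 = 1" by (simp add: w_def assms fps_const_power)
    moreover obtain j where "i = 7 * j" using True by (elim dvdE)
    then have "w ^ (k * i) = (w ^ 7) ^ (k * j)" for k
      by (simp add: mult.left_commute flip: power_mult)
    ultimately have "w ^ (k * i) = 1" for k by simp
    then show ?thesis using True by (simp add: power_mult_distrib flip: power_mult)
  next
    case False
    have "1 + w ^ i + (w ^ i)^2 + (w ^ i)^3 + (w ^ i)^4 + (w ^ i)^5 + (w ^ i)^6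
        = fps_const (1 + \<zeta> ^ i + (\<zeta> ^ i)^2 + (\<zeta> ^ i)^3 + (\<zeta> ^ i)^4 + (\<zeta> ^ i)^5 + (\<zeta> ^ i)^6)"
      by (simp add: w_def fps_const_power flip: fps_const_add)
    also have "\<dots> = 0" by (simp add: root_of_unity_7_sum[OF assms(1,2) False])
    finally have "(\<Prod>k<7. 1 - (w ^ i) ^ k * q ^ i) = 1 - (q ^ i) ^ 7"
      by (rule prod_one_minus_root)
    then show ?thesis
      using False by (simp add: power_mult_distrib mult.commute flip: power_mult)
  qed
  have "(\<Prod>k<7. qpoch (fps_const (\<zeta> ^ k) * q) (7 * n)) = (\<Prod>i=1..7 * n. \<Prod>k<7. 1 - (w ^ k * q) ^ i)"
    unfolding qpoch_def w_def fps_const_power by (rule prod.swap)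
  moreover have "qpoch (q ^ 49) n = (\<Prod>i=1..7 * n. if 7 dvd i then 1 - q ^ (7 * i) else 1)"
    unfolding prod_multiples_7 qpoch_def by (simp flip: power_mult)
  moreover have "qpoch (q ^ 7) (7 * n) = (\<Prod>i=1..7 * n. 1 - q ^ (7 * i))"
    unfolding qpoch_def by (simp flip: power_mult)
  moreover have "qpoch (q ^ 7) n ^ 7 = (\<Prod>i=1..7 * n. if 7 dvd i then (1 - q ^ i) ^ 7 else 1)"
    unfolding prod_multiples_7 qpoch_def by (simp add: prod_power_distrib flip: power_mult)
  ultimately show ?thesis
    by (simp only: factor flip: prod.distrib)
qed

lemma prod_euler_fps_roots:
  fixes \<zeta> :: complex
  assumes "\<zeta> ^ 7 = 1" "\<zeta> \<noteq> 1"
  shows "(\<Prod>k<7. euler_fps oo (fps_const (\<zeta> ^ k) * fps_X)) * (euler_fps oo fps_X ^ 49)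
    = (euler_fps oo fps_X ^ 7) ^ 8"
proof (rule fps_eqI_dvd)
  fix n
  let ?q = "fps_X :: complex fps"
  have "?q ^ n dvd (\<Prod>k<7. euler_fps oo (fps_const (\<zeta> ^ k) * ?q)) * (euler_fps oo ?q ^ 49)
      - (\<Prod>k<7. qpoch (fps_const (\<zeta> ^ k) * ?q) (7 * n)) * qpoch (?q ^ 49) n"
    by (intro dvd_diff_mult dvd_diff_prod euler_fps_compose_cong) simp_all
  moreover have "?q ^ n dvd qpoch (?q ^ 7) (7 * n) * qpoch (?q ^ 7) n ^ 7
      - (euler_fps oo ?q ^ 7) * (euler_fps oo ?q ^ 7) ^ 7"
    by (rule dvd_diff_swap, intro dvd_diff_mult dvd_diff_power euler_fps_compose_cong) simp_all
  ultimately have "?q ^ n dvd (\<Prod>k<7. euler_fps oo (fps_const (\<zeta> ^ k) * ?q)) * (euler_fps oo ?q ^ 49)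
      - (euler_fps oo ?q ^ 7) * (euler_fps oo ?q ^ 7) ^ 7"
    unfolding prod_qpoch_roots[OF assms] by (rule dvd_diff_trans)
  then show "?q ^ n dvd (\<Prod>k<7. euler_fps oo (fps_const (\<zeta> ^ k) * ?q)) * (euler_fps oo ?q ^ 49)
      - (euler_fps oo ?q ^ 7) ^ 8"
    by (simp flip: power_Suc)
qed

lemma fps_compose_X_power_inject:
  fixes f g :: "'a::idom fps"
  assumes "m > 0" "f oo fps_X ^ m = g oo fps_X ^ m"
  shows "f = g"
proof (rule fps_ext)
  fix n
  have "(f oo fps_X ^ m) $ (n * m) = (g oo fps_X ^ m) $ (n * m)" by (simp add: assms)
  then show "f $ n = g $ n" using assms(1) by (simp add: fps_nth_compose_X_power)
qed

lemma homogeneous7_compose_X_power: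
  fixes f :: "'a::idom fps"
  assumes "m > 0" "7 dvd m"
  shows "homogeneous7 0 (f oo fps_X ^ m)"
  using assms by (auto simp: homogeneous7_def fps_nth_compose_X_power)

lemma euler_fps_dissection:
  fixes \<zeta> :: complex
  assumes "\<zeta> ^ 7 = 1" "\<zeta> \<noteq> 1"
  obtains a b c d :: "complex fps" where
    "homogeneous7 0 a" "homogeneous7 1 b" "homogeneous7 5 c" "homogeneous7 2 d"
    "euler_fps = a + b + c + d" "d = - (fps_X ^ 2 * (euler_fps oo fps_X ^ 49))"
    "a * b * c = d^3" "a^2 * d + a * b^2 + c * d^2 = 0"
    "b^2 * d + a * d^2 + b * c^2 = 0" "a^2 * c + b * d^2 + c^2 * d = 0"
proof -
  define a b c d :: "complex fps"
    where "a = residue7 0 euler_fps" and "b = residue7 1 euler_fps"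
      and "c = residue7 5 euler_fps" and "d = residue7 2 euler_fps"
  have hom: "homogeneous7 0 a" "homogeneous7 1 b" "homogeneous7 5 c" "homogeneous7 2 d"
    by (simp_all add: a_def b_def c_def d_def homogeneous7_residue7)
  have "{..<7} = {0, 1, 5, 2, 3, 4, 6 :: nat}" by auto
  then have euler: "euler_fps = a + b + c + d"
    using sum_residue7[of "euler_fps :: complex fps"]
    by (simp add: a_def b_def c_def d_def residue7_euler_fps_eq_0 add.assoc)
  have d: "d = - (fps_X ^ 2 * (euler_fps oo fps_X ^ 49))"
    unfolding d_def by (rule residue7_2_euler_fps)
  have "d ^ 3 = - (fps_X ^ 6 * (euler_fps oo fps_X ^ 49) ^ 3)"
    unfolding d by algebra
  \<comment> \<open>Class 6 of the cube is \<open>7 * d ^ 3\<close> by Jacobi's series and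
    \<open>6 * (a * b * c) + d ^ 3\<close> by expansion; comparing the two gives the first
    relation.\<close>
  then have "residue7 6 ((a + b + c + d) ^ 3) = 7 * d ^ 3"
    unfolding euler[symmetric] residue7_6_euler_fps_cube by simp
  then have "6 * (a * b * c) = 6 * d ^ 3"
    unfolding residue7_cube[OF hom] by simp
  then have "a * b * c = d^3" by simp
  moreover have "a^2 * d + a * b^2 + c * d^2 = 0" "b^2 * d + a * d^2 + b * c^2 = 0"
    "a^2 * c + b * d^2 + c^2 * d = 0"
    \<comment> \<open>The other relations, up to the factor 3, are the vanishing classes 2, 4 and 5
      of the cube.\<close>
    using residue7_cube[OF hom] residue7_euler_fps_cube_eq_0[where 'a = complex]
    by (simp_all flip: euler del: distrib_left_numeral)
  ultimately show ?thesis using that hom euler d by blast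
qed

text \<open>Denominators are cleared by \<open>euler_fps ^ 8\<close>. The identity is first obtained
  in \<open>fps_X ^ 7\<close>, a substitution that is injective on power series.\<close>

theorem ramanujan_mod_7_complex:
  defines "R \<equiv> Abs_fps (\<lambda>n. of_nat (num_partitions (7 * n + 5))) :: complex fps"
  shows "R * euler_fps ^ 8 = 7 * ((euler_fps oo fps_X ^ 7) ^ 3 * euler_fps ^ 4)
     + 49 * (fps_X * (euler_fps oo fps_X ^ 7) ^ 7)"
proof -
  let ?E = "euler_fps :: complex fps" and ?X = "fps_X :: complex fps"
  define E7 where "E7 = ?E oo ?X ^ 7"
  define E49 where "E49 = ?E oo ?X ^ 49"
  define P :: "complex fps" where "P = Abs_fps (\<lambda>n. of_nat (num_partitions n))"
  obtain \<zeta> :: complex where \<zeta>: "\<zeta> ^ 7 = 1" "\<zeta> \<noteq> 1" using ex_root_of_unity_7 by blast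
  obtain a b c d :: "complex fps" where hom:
    "homogeneous7 0 a" "homogeneous7 1 b" "homogeneous7 5 c" "homogeneous7 2 d"
    and E: "?E = a + b + c + d" and d: "d = - (?X ^ 2 * E49)"
    and rels: "a * b * c = d^3" "a^2 * d + a * b^2 + c * d^2 = 0"
      "b^2 * d + a * d^2 + b * c^2 = 0" "a^2 * c + b * d^2 + c^2 * d = 0"
    using euler_fps_dissection[OF \<zeta>] unfolding E49_def by metis
  define K where "K = a^3 * b + b^3 * c + c^3 * a + 8 * d^4"
  define w where "w = fps_const \<zeta>"
  have w: "1 + w + w^2 + w^3 + w^4 + w^5 + w^6 = 0"
  proof -
    have "1 + w + w^2 + w^3 + w^4 + w^5 + w^6 = fps_const (1 + \<zeta> + \<zeta>^2 + \<zeta>^3 + \<zeta>^4 + \<zeta>^5 + \<zeta>^6)"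
      by (simp add: w_def fps_const_power flip: fps_const_add)
    then show ?thesis using root_of_unity_7_sum[OF \<zeta>, of 1] by simp
  qed
  have "?E oo (fps_const (\<zeta> ^ k) * ?X) = a + w^k * b + (w^k)^5 * c + (w^k)^2 * d" for k
  proof -
    have "(\<zeta> ^ k) ^ 7 = (\<zeta> ^ 7) ^ k" by (simp add: mult.commute flip: power_mult)
    then have "(\<zeta> ^ k) ^ 7 = 1" using \<zeta> by simp
    note root = fps_compose_root_homogeneous7[OF this]
    show ?thesis
      unfolding E fps_compose_add_distrib root[OF hom(1)] root[OF hom(2)] root[OF hom(3)] root[OF hom(4)]
      by (simp add: w_def fps_const_power)
  qed
  then have "(\<Prod>k<7. ?E oo (fps_const (\<zeta> ^ k) * ?X))
      = (\<Prod>k\<in>insert 0 {1..6}. a + w^k * b + (w^k)^5 * c + (w^k)^2 * d)"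
    by (intro prod.cong) auto
  also have "\<dots> = ?E * (\<Prod>k=1..6. a + w^k * b + (w^k)^5 * c + (w^k)^2 * d)"
    unfolding E by simp
  also have "\<dots> = ?E * norm_cofactor a b c d"
    unfolding prod_norm_cofactor[OF w] ..
  finally have norm: "?E * norm_cofactor a b c d * E49 = E7 ^ 8"
    using prod_euler_fps_roots[OF \<zeta>] by (simp add: E7_def E49_def)
  have "d * (?E * norm_cofactor a b c d) = - (K ^ 2)"
    unfolding E K_def by (rule norm_eq_square[OF rels])
  then have "K ^ 2 = (?X * E7 ^ 4) ^ 2"
    using norm unfolding d by algebra
  then have K: "K = ?X * E7 ^ 4 \<or> K = - (?X * E7 ^ 4)" by (simp only: power2_eq_iff)
  have hom49: "homogeneous7 0 E49" and hom7: "homogeneous7 0 (E7 ^ 8)"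
    unfolding E49_def E7_def
    by (rule homogeneous7_compose_X_power; simp)
      (rule homogeneous7_power[where s = 0, simplified], rule homogeneous7_compose_X_power; simp)
  have "P * ?E = 1" unfolding P_def by (rule partitions_gf)
  \<comment> \<open>Both \<open>E7 ^ 8\<close> and \<open>E49\<close> have weight 0, so class 5 of
    \<open>P\<close> can be read off from class 5 of the cofactor.\<close>
  then have "E7 ^ 8 * P = E49 * norm_cofactor a b c d"
    unfolding norm[symmetric] by algebra
  then have "E7 ^ 8 * residue7 5 P = E49 * (49 * d^6 - 7 * d^2 * K)"
    using residue7_mult_homogeneous7[OF hom7, of 5 P] residue7_mult_homogeneous7[OF hom49]
    by (simp add: residue7_norm_cofactor[OF hom rels] K_def)
  also have "\<dots> = 49 * ?X ^ 12 * E49 ^ 7 - 7 * ?X ^ 4 * E49 ^ 3 * K"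
    unfolding d by algebra
  finally have P5: "E7 ^ 8 * residue7 5 P = 49 * ?X ^ 12 * E49 ^ 7 - 7 * ?X ^ 4 * E49 ^ 3 * K" .
  have residue_P: "residue7 5 P = ?X ^ 5 * (R oo ?X ^ 7)"
  proof (rule fps_ext)
    fix n
    show "residue7 5 P $ n = (?X ^ 5 * (R oo ?X ^ 7)) $ n"
    proof (cases "n mod 7 = 5")
      case True
      define m where "m = n div 7"
      have "n = 7 * m + 5" using True unfolding m_def by presburger
      then show ?thesis
        by (simp add: residue7_nth fps_X_power_mult_nth fps_nth_compose_X_power P_def R_def)
    next
      case False
      then have "n < 5 \<or> \<not> 7 dvd n - 5" by presburger
      then show ?thesis
        using False by (auto simp: residue7_nth fps_X_power_mult_nth fps_nth_compose_X_power)
    qed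
  qed
  have const: "E7 $ 0 = 1" "E49 $ 0 = 1" by (simp_all add: E7_def E49_def)
  \<comment> \<open>With the positive sign, the constant coefficients would force
    \<open>num_partitions 5\<close> to equal -7.\<close>
  have "K \<noteq> ?X * E7 ^ 4"
  proof
    assume K: "K = ?X * E7 ^ 4"
    have "?X ^ 5 * (E7 ^ 8 * (R oo ?X ^ 7)) = ?X ^ 5 * (49 * ?X ^ 7 * E49 ^ 7 - 7 * E49 ^ 3 * E7 ^ 4)"
      using P5 unfolding residue_P K by algebra
    then have "E7 ^ 8 * (R oo ?X ^ 7) = 49 * ?X ^ 7 * E49 ^ 7 - 7 * E49 ^ 3 * E7 ^ 4"
      by simp
    then have "(E7 ^ 8 * (R oo ?X ^ 7)) $ 0 = (49 * ?X ^ 7 * E49 ^ 7 - 7 * E49 ^ 3 * E7 ^ 4) $ 0"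
      by simp
    then have "of_nat (num_partitions 5) = (- 7 :: complex)"
      by (simp add: R_def const fps_mult_nth_0 fps_power_zeroth)
    then have "of_nat (num_partitions 5 + 7) = (0 :: complex)" by simp
    then show False unfolding of_nat_eq_0_iff by simp
  qed
  with K have "K = - (?X * E7 ^ 4)" by blast
  then have "?X ^ 5 * (E7 ^ 8 * (R oo ?X ^ 7)) = ?X ^ 5 * (7 * (E49 ^ 3 * E7 ^ 4) + 49 * (?X ^ 7 * E49 ^ 7))"
    using P5 unfolding residue_P by algebra
  then have "(R oo ?X ^ 7) * E7 ^ 8 = 7 * (E49 ^ 3 * E7 ^ 4) + 49 * (?X ^ 7 * E49 ^ 7)"
    by (simp add: mult.commute)
  also have "E49 = E7 oo ?X ^ 7"
    unfolding E7_def E49_def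
    by (subst fps_compose_assoc[symmetric])
      (simp_all add: fps_compose_power[symmetric] fps_X_fps_compose_startby0 flip: power_mult)
  finally have "(R * ?E ^ 8) oo ?X ^ 7 = (7 * (E7 ^ 3 * ?E ^ 4) + 49 * (?X * E7 ^ 7)) oo ?X ^ 7"
    by (simp add: fps_compose_mult_distrib fps_compose_add_distrib fps_compose_power E7_def
        fps_X_fps_compose_startby0 numeral_fps_const)
  then show ?thesis
    unfolding E7_def by (rule fps_compose_X_power_inject[rotated]) simp
qed

subsection \<open>Logarithmic derivatives and Bell polynomials\<close>

text \<open>\<open>h\<close> is \<open>fps_X\<close> times the logarithmic derivative of
  \<open>f\<close>, stated without division. Products of series become sums.\<close>

definition has_log_deriv :: "'a::comm_ring_1 fps \<Rightarrow> 'a fps \<Rightarrow> bool" where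
  "has_log_deriv f h \<longleftrightarrow> fps_X * fps_deriv f = f * h"

lemma has_log_deriv_mult:
  assumes "has_log_deriv f h" "has_log_deriv g k"
  shows "has_log_deriv (f * g) (h + k)"
proof -
  have "fps_X * fps_deriv (f * g) = (fps_X * fps_deriv f) * g + f * (fps_X * fps_deriv g)"
    by (simp add: algebra_simps)
  also have "\<dots> = (f * h) * g + f * (g * k)"
    using assms by (simp only: has_log_deriv_def)
  finally show ?thesis by (simp add: has_log_deriv_def algebra_simps)
qed

lemma has_log_deriv_power:
  assumes "has_log_deriv f h"
  shows "has_log_deriv (f ^ n) (of_nat n * h)"
proof (induction n)
  case 0
  then show ?case by (simp add: has_log_deriv_def)
next
  case (Suc n)
  then show ?case using has_log_deriv_mult[OF assms Suc] by (simp add: distrib_right)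
qed

lemma has_log_deriv_inverse:
  fixes f g :: "'a::idom fps"
  assumes "has_log_deriv f h" "g * f = 1"
  shows "has_log_deriv g (- h)"
proof -
  have "fps_deriv (g * f) = 0" by (simp add: assms(2))
  then have "f * (fps_X * fps_deriv g) = - (g * (fps_X * fps_deriv f))"
    by (simp add: algebra_simps eq_neg_iff_add_eq_0 flip: distrib_left)
  also have "\<dots> = f * (g * - h)"
    using assms(1) by (simp add: has_log_deriv_def algebra_simps)
  finally have "f * (fps_X * fps_deriv g) = f * (g * - h)" .
  moreover have "f \<noteq> 0" using assms(2) by auto
  ultimately show ?thesis by (simp only: has_log_deriv_def mult_cancel_left simp_thms)
qed

text \<open>The quotient of \<open>f\<close> and \<open>g\<close> has derivative 0, hence is
  constant in characteristic 0.\<close>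

lemma has_log_deriv_unique:
  fixes f g :: "'a::field_char_0 fps"
  assumes "has_log_deriv f h" "has_log_deriv g h" "f $ 0 = g $ 0" "g $ 0 \<noteq> 0"
  shows "f = g"
proof -
  have inv: "inverse g * g = 1" using assms(4) by (rule inverse_mult_eq_1)
  have "has_log_deriv (f * inverse g) (h + - h)"
    by (intro has_log_deriv_mult has_log_deriv_inverse[OF _ inv] assms)
  then have "fps_deriv (f * inverse g) = 0" by (simp add: has_log_deriv_def)
  then have "f * inverse g = fps_const ((f * inverse g) $ 0)" by (simp only: fps_deriv_eq_0_iff)
  also have "(f * inverse g) $ 0 = 1" using assms(3,4) by simp
  finally have "f * (inverse g * g) = g" by (simp flip: mult.assoc)
  then show ?thesis by (simp add: inv)
qed

section \<open>Divisor sums as the logarithmic derivative of the Euler product\<close>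

definition sigma_fps :: "'a::comm_ring_1 fps" where
  "sigma_fps = Abs_fps (\<lambda>n. of_nat (sigma n))"

text \<open>Every number divides 0, and a sum over an infinite set is 0 by convention.\<close>

lemma sigma_0 [simp]: "sigma 0 = 0"
  by (simp add: sigma_def)

lemma fps_X_deriv_nth: "(fps_X * fps_deriv f) $ n = of_nat n * f $ n"
  by (cases n) simp_all

lemma has_log_deriv_qpoch:
  "has_log_deriv (qpoch fps_X n :: 'a::comm_ring_1 fps)
     (- (\<Sum>i=1..n. of_nat i * Abs_fps (\<lambda>m. if m > 0 \<and> i dvd m then 1 else 0)))"
proof (induction n)
  case 0
  then show ?case by (simp add: has_log_deriv_def)
next
  case (Suc n)
  let ?G = "Abs_fps (\<lambda>m. if m > 0 \<and> Suc n dvd m then 1 else 0) :: 'a fps"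
  \<comment> \<open>\<open>?G\<close> is the geometric series of the positive multiples of
    \<open>Suc n\<close>, the expansion needed to differentiate the new factor
    logarithmically.\<close>
  have "?G = fps_X ^ Suc n + fps_X ^ Suc n * ?G"
  proof (rule fps_ext)
    fix m
    show "?G $ m = (fps_X ^ Suc n + fps_X ^ Suc n * ?G) $ m"
      by (cases "m = Suc n")
        (auto simp: fps_X_power_mult_nth dvd_minus_self simp del: power_Suc dest: dvd_imp_le)
  qed
  then have G: "(1 - fps_X ^ Suc n) * ?G = fps_X ^ Suc n" by (simp add: algebra_simps del: power_Suc)
  have "fps_X * fps_deriv (1 - fps_X ^ Suc n) = - (of_nat (Suc n) * fps_X ^ Suc n :: 'a fps)"
    by (rule fps_ext) (auto simp: fps_X_deriv_nth fps_of_nat[symmetric] simp del: power_Suc of_nat_Suc)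
  also have "\<dots> = (1 - fps_X ^ Suc n) * - (of_nat (Suc n) * ?G)"
    by (subst (1) G[symmetric]) (simp add: algebra_simps del: power_Suc)
  finally have "has_log_deriv (1 - fps_X ^ Suc n) (- (of_nat (Suc n) * ?G))"
    by (simp only: has_log_deriv_def)
  from has_log_deriv_mult[OF this Suc] show ?case
    by (simp add: qpoch_Suc algebra_simps del: power_Suc of_nat_Suc)
qed

theorem has_log_deriv_euler_fps: "has_log_deriv euler_fps (- sigma_fps :: 'a::comm_ring_1 fps)"
  unfolding has_log_deriv_def
proof (rule fps_eqI_dvd)
  fix n
  define L :: "'a fps"
    where "L = (\<Sum>i=1..n. of_nat i * Abs_fps (\<lambda>m. if m > 0 \<and> i dvd m then 1 else 0))"
  have euler: "fps_X ^ n dvd (euler_fps - qpoch fps_X n :: 'a fps)"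
    by (rule euler_fps_cong') simp
  then have "fps_X ^ n dvd fps_X * fps_deriv (euler_fps - qpoch fps_X n :: 'a fps)"
    by (auto simp: fps_X_power_dvd_iff)
  then have "fps_X ^ n dvd fps_X * fps_deriv euler_fps - fps_X * fps_deriv (qpoch fps_X n :: 'a fps)"
    by (simp add: right_diff_distrib)
  moreover have "sigma_fps $ m = L $ m" if "m < n" for m
  proof (cases "m = 0")
    case False
    have "L $ m = (\<Sum>i=1..n. if i dvd m then of_nat i else 0)"
      using False by (auto simp: L_def fps_sum_nth fps_of_nat[symmetric] intro!: sum.cong)
    also have "\<dots> = (\<Sum>i | i \<in> {1..n} \<and> i dvd m. of_nat i)"
      by (simp only: sum.inter_filter finite_atLeastAtMost)
    also have "{i. i \<in> {1..n} \<and> i dvd m} = {i. i dvd m}"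
      using False that by (auto dest: dvd_imp_le intro: Suc_leI dvd_pos_nat)
    finally show ?thesis by (simp add: sigma_fps_def sigma_def)
  qed (simp add: L_def sigma_fps_def fps_sum_nth fps_of_nat[symmetric])
  then have "fps_X ^ n dvd (- L) - (- sigma_fps)" by (simp add: fps_X_power_dvd_iff)
  then have "fps_X ^ n dvd qpoch fps_X n * - L - euler_fps * - sigma_fps"
    by (intro dvd_diff_mult dvd_diff_swap[OF euler])
  then have "fps_X ^ n dvd (fps_X * fps_deriv (qpoch fps_X n) - euler_fps * - sigma_fps :: 'a fps)"
    using has_log_deriv_qpoch[of n, where 'a = 'a]
    unfolding has_log_deriv_def L_def[symmetric] by (simp only:)
  ultimately show "fps_X ^ n dvd (fps_X * fps_deriv euler_fps - euler_fps * - sigma_fps :: 'a fps)"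
    by (rule dvd_diff_trans)
qed

lemma has_log_deriv_compose_X_power:
  fixes f :: "'a::field fps"
  assumes "has_log_deriv f h" "m > 0"
  shows "has_log_deriv (f oo fps_X ^ m) (of_nat m * (h oo fps_X ^ m))"
proof -
  have X: "fps_X * fps_X ^ (m - 1) = (fps_X ^ m :: 'a fps)"
    using power_minus_mult[OF assms(2), of "fps_X :: 'a fps"] by (simp only: mult.commute)
  have "fps_X * fps_deriv (f oo fps_X ^ m)
      = of_nat m * ((fps_X * fps_X ^ (m - 1)) * (fps_deriv f oo fps_X ^ m))"
    using assms(2) by (simp add: fps_compose_deriv fps_deriv_power fps_of_nat ac_simps)
  also have "\<dots> = of_nat m * ((fps_X * fps_deriv f) oo fps_X ^ m)"
    unfolding X using assms(2) by (simp add: fps_compose_mult_distrib fps_X_fps_compose_startby0)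
  also have "\<dots> = (f oo fps_X ^ m) * (of_nat m * (h oo fps_X ^ m))"
    using assms by (simp add: has_log_deriv_def fps_compose_mult_distrib ac_simps)
  finally show ?thesis by (simp add: has_log_deriv_def)
qed

section \<open>Divisor sums and the exponent of 7\<close>

definition sigma_prime_to_7 :: "nat \<Rightarrow> nat" where
  "sigma_prime_to_7 k = sigma (k div 7 ^ multiplicity 7 k)"

text \<open>The divisors that are multiples of 7 are 7 times the divisors of
  \<open>7 ^ m * k\<close>; the remaining ones are coprime to 7 and divide \<open>k\<close>.\<close>

lemma sigma_7_power_mult_Suc:
  assumes "\<not> 7 dvd k"
  shows "sigma (7 ^ Suc m * k) = 7 * sigma (7 ^ m * k) + sigma k"
proof -
  have k: "k > 0" using assms by (intro Nat.gr0I) simp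
  have "{d. d dvd 7 ^ Suc m * k} = (\<lambda>d. 7 * d) ` {d. d dvd 7 ^ m * k} \<union> {d. d dvd k}"
  proof (intro equalityI subsetI)
    fix d assume d: "d \<in> {d. d dvd 7 ^ Suc m * k}"
    show "d \<in> (\<lambda>d. 7 * d) ` {d. d dvd 7 ^ m * k} \<union> {d. d dvd k}"
    proof (cases "7 dvd d")
      case True
      then obtain e where "d = 7 * e" by (elim dvdE)
      then show ?thesis using d by (auto simp: mult.assoc)
    next
      case False
      have "prime (7::nat)" by simp
      then have "coprime 7 d" using False by (rule prime_imp_coprime)
      then have "coprime d (7 ^ Suc m)" by (simp only: coprime_power_right_iff coprime_commute simp_thms)
      then have "d dvd k" using d by (simp add: coprime_dvd_mult_right_iff del: power_Suc)
      then show ?thesis by simp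
    qed
  qed (auto simp: mult.assoc)
  moreover have "(\<lambda>d. 7 * d) ` {d. d dvd 7 ^ m * k} \<inter> {d. d dvd k} = {}"
    using assms by (auto dest: dvd_mult_left)
  ultimately have "sigma (7 ^ Suc m * k) = (\<Sum>d\<in>(\<lambda>d. 7 * d) ` {d. d dvd 7 ^ m * k}. d) + sigma k"
    using k by (simp add: sigma_def sum.union_disjoint del: power_Suc)
  also have "(\<Sum>d\<in>(\<lambda>d. 7 * d) ` {d. d dvd 7 ^ m * k}. d) = 7 * sigma (7 ^ m * k)"
    by (subst sum.reindex) (auto simp: inj_on_def sigma_def sum_distrib_left)
  finally show ?thesis .
qed

lemma sigma_7_power_mult:
  assumes "\<not> 7 dvd k"
  shows "6 * real (sigma (7 ^ m * k)) = (7 ^ (m + 1) - 1) * real (sigma k)"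
proof (induction m)
  case (Suc m)
  have "6 * real (sigma (7 ^ Suc m * k)) = 7 * (6 * real (sigma (7 ^ m * k))) + 6 * real (sigma k)"
    unfolding sigma_7_power_mult_Suc[OF assms] by simp
  then show ?case unfolding Suc by (simp add: algebra_simps)
qed simp

text \<open>By \<open>sigma_7_power_mult\<close>, the denominator in the second claim cancels and
  leaves \<open>c\<close> times the divisor sum of the part prime to 7. The values
  \<open>c = 3\<close> and \<open>c = 7\<close> give the constants 18 and 42.\<close>

lemma sigma_div_7:
  assumes "k > 0"
  shows "sigma k = (if 7 dvd k then 7 * sigma (k div 7) else 0) + sigma_prime_to_7 k"
    and "real (sigma k) * (1 + 6 * c / (7 ^ (multiplicity 7 k + 1) - 1))
      = real (sigma k) + c * real (sigma_prime_to_7 k)"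
proof -
  define m where "m = multiplicity 7 k"
  obtain l where l: "k = 7 ^ m * l" "\<not> 7 dvd l"
    unfolding m_def using multiplicity_decompose'[of k 7] assms by auto
  have s: "sigma_prime_to_7 k = sigma l"
    unfolding sigma_prime_to_7_def m_def[symmetric] by (simp add: l(1))
  show "sigma k = (if 7 dvd k then 7 * sigma (k div 7) else 0) + sigma_prime_to_7 k"
  proof (cases m)
    case 0
    then show ?thesis using l unfolding s by simp
  next
    case (Suc m')
    have "k div 7 = 7 ^ m' * l" unfolding l(1) Suc by (simp add: mult.assoc)
    then show ?thesis using sigma_7_power_mult_Suc[OF l(2), of m'] Suc
      unfolding s by (simp add: l(1) mult.assoc)
  qed
  define t where "t = (7::real) ^ (m + 1) - 1"
  have "t > 0" using one_less_power[of "7::real" "m + 1"] by (simp add: t_def)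
  moreover have eq: "6 * real (sigma k) = t * real (sigma l)"
    unfolding l(1) t_def by (rule sigma_7_power_mult[OF l(2)])
  have "real (sigma k) * (1 + 6 * c / t) = real (sigma k) + c * (6 * real (sigma k)) / t"
    by (simp add: algebra_simps)
  ultimately show "real (sigma k) * (1 + 6 * c / (7 ^ (multiplicity 7 k + 1) - 1))
      = real (sigma k) + c * real (sigma_prime_to_7 k)"
    unfolding s m_def[symmetric] t_def[symmetric] eq by simp
qed

text \<open>The right-hand side is coefficient \<open>k\<close> of the logarithmic derivative of
  \<open>E(q^7)^3 / E(q)^4\<close>, with \<open>21 = 3 * 7\<close>.\<close>

lemma mult_d_seq:
  assumes "k > 0"
  shows "real k * d_seq k = 4 * real (sigma k) - (if 7 dvd k then 21 * real (sigma (k div 7)) else 0)"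
  using assms sigma_div_7(2)[OF assms, of 3] arg_cong[OF sigma_div_7(1)[OF assms], of real]
  by (simp add: d_seq_def)

lemma mult_e_seq:
  assumes "k > 0"
  shows "real k * e_seq k = 8 * real (sigma k) - (if 7 dvd k then 49 * real (sigma (k div 7)) else 0)"
  using assms sigma_div_7(2)[OF assms, of 7] arg_cong[OF sigma_div_7(1)[OF assms], of real]
  by (simp add: e_seq_def)

lemma of_real_fps_power_nth:
  "of_real ((f ^ k) $ n) = (Abs_fps (\<lambda>n. of_real (f $ n)) ^ k :: 'a::{real_algebra_1,comm_ring_1} fps) $ n"
  by (induction k arbitrary: n) (simp_all add: fps_mult_nth)

text \<open>The factorials in the arguments cancel those of the generating function, whose
  exponential then has logarithmic derivative \<open>h\<close> and constant term 1, which determines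
  it as \<open>G\<close>.\<close>

lemma bell_eq_nth:
  fixes G :: "complex fps" and x :: "nat \<Rightarrow> real"
  assumes "has_log_deriv G h" "G $ 0 = 1" "h $ 0 = 0"
    and "\<And>k. k > 0 \<Longrightarrow> h $ k = of_real (real k * x k)"
  shows "of_real (bell n (\<lambda>k. fact k * x k)) = fact n * G $ n"
proof -
  define L where "L = Abs_fps (\<lambda>k. if k = 0 then 0 else of_real (x k) :: complex)"
  have "fps_X * fps_deriv L = h"
  proof (rule fps_ext)
    fix k show "(fps_X * fps_deriv L) $ k = h $ k"
      using assms(3) assms(4)[of k] by (cases k) (simp_all add: L_def)
  qed
  moreover have "fps_deriv (fps_exp 1 oo L) = (fps_exp 1 oo L) * fps_deriv L"
    by (subst fps_compose_deriv) (simp_all add: L_def)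
  ultimately have "has_log_deriv (fps_exp 1 oo L) h"
    by (simp add: has_log_deriv_def mult.left_commute)
  moreover have "(fps_exp 1 oo L) $ 0 = 1" by simp
  ultimately have "fps_exp 1 oo L = G"
    using assms(1,2) by (intro has_log_deriv_unique) simp_all
  moreover have "of_real ((fps_exp 1 oo Abs_fps (\<lambda>m. if m = 0 then 0 else fact m * x m / fact m)) $ n)
      = (fps_exp 1 oo L) $ n"
    unfolding fps_compose_nth of_real_sum of_real_mult of_real_fps_power_nth L_def
    by (intro sum.cong refl arg_cong2[where f = times] arg_cong[where f = "\<lambda>f. (f ^ _) $ _"])
      (simp_all add: fps_eq_iff)
  ultimately show ?thesis by (simp add: bell_def)
qed

theorem theorem2:
  fixes n :: nat
  assumes "n \<ge> 1"
  shows "7 * bell n (\<lambda>k. fact k * d_seq k) + 49 * real n * bell (n - 1) (\<lambda>k. fact k * e_seq k)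
           = fact n * real (num_partitions (7 * n + 5))"
proof -
  let ?E = "euler_fps :: complex fps" and ?S = "sigma_fps :: complex fps"
  define P where "P = Abs_fps (\<lambda>n. of_nat (num_partitions n) :: complex)"
  define E7 where "E7 = ?E oo fps_X ^ 7"
  define S7 where "S7 = ?S oo fps_X ^ 7"
  have P: "P * ?E = 1" unfolding P_def by (rule partitions_gf)
  have log_P: "has_log_deriv P ?S"
    using has_log_deriv_inverse[OF has_log_deriv_euler_fps P] by simp
  have log_E7: "has_log_deriv E7 (7 * - S7)"
    using has_log_deriv_compose_X_power[OF has_log_deriv_euler_fps[where 'a = complex], of 7]
    by (simp add: E7_def S7_def fps_compose_uminus)
  have P_0: "P $ 0 = 1" using arg_cong[OF P, of "\<lambda>f. f $ 0"] by simp
  have E7_0: "E7 $ 0 = 1" by (simp add: E7_def)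
  have bell_d: "of_real (bell n (\<lambda>k. fact k * d_seq k)) = fact n * (E7 ^ 3 * P ^ 4) $ n" for n
  proof (rule bell_eq_nth)
    show "has_log_deriv (E7 ^ 3 * P ^ 4) (of_nat 3 * (7 * - S7) + of_nat 4 * ?S)"
      by (intro has_log_deriv_mult has_log_deriv_power log_P log_E7)
    fix k :: nat assume "k > 0"
    then show "(of_nat 3 * (7 * - S7) + of_nat 4 * ?S) $ k = of_real (real k * d_seq k)"
      unfolding mult_d_seq[OF \<open>k > 0\<close>]
      by (simp add: S7_def sigma_fps_def fps_nth_compose_X_power numeral_fps_const)
  qed (simp_all add: P_0 E7_0 S7_def sigma_fps_def fps_power_zeroth)
  have bell_e: "of_real (bell n (\<lambda>k. fact k * e_seq k)) = fact n * (E7 ^ 7 * P ^ 8) $ n" for n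
  proof (rule bell_eq_nth)
    show "has_log_deriv (E7 ^ 7 * P ^ 8) (of_nat 7 * (7 * - S7) + of_nat 8 * ?S)"
      by (intro has_log_deriv_mult has_log_deriv_power log_P log_E7)
    fix k :: nat assume "k > 0"
    then show "(of_nat 7 * (7 * - S7) + of_nat 8 * ?S) $ k = of_real (real k * e_seq k)"
      unfolding mult_e_seq[OF \<open>k > 0\<close>]
      by (simp add: S7_def sigma_fps_def fps_nth_compose_X_power numeral_fps_const)
  qed (simp_all add: P_0 E7_0 S7_def sigma_fps_def fps_power_zeroth)
  obtain m where m: "n = Suc m" using assms by (cases n) auto
  \<comment> \<open>Multiplication by \<open>P ^ 8\<close>, the inverse of \<open>?E ^ 8\<close>,
    turns Ramanujan's identity into quotient form.\<close>
  have "Abs_fps (\<lambda>n. of_nat (num_partitions (7 * n + 5))) = 7 * (E7 ^ 3 * P ^ 4) + 49 * (fps_X * (E7 ^ 7 * P ^ 8))"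
    using ramanujan_mod_7_complex P unfolding E7_def[symmetric] by algebra
  from arg_cong[OF this, of "\<lambda>f. f $ n"]
  have coeff: "of_nat (num_partitions (7 * n + 5)) = 7 * (E7 ^ 3 * P ^ 4) $ n + 49 * (E7 ^ 7 * P ^ 8) $ m"
    by (simp add: numeral_fps_const m)
  have "of_real (7 * bell n (\<lambda>k. fact k * d_seq k) + 49 * real n * bell (n - 1) (\<lambda>k. fact k * e_seq k))
      = 7 * (fact n * (E7 ^ 3 * P ^ 4) $ n) + 49 * of_nat n * (fact m * (E7 ^ 7 * P ^ 8) $ m)"
    by (simp only: of_real_add of_real_mult of_real_numeral of_real_of_nat_eq bell_d bell_e m diff_Suc_1)
  \<comment> \<open>The factor \<open>n\<close> completes \<open>fact m\<close> to
    \<open>fact n\<close>, as \<open>n = Suc m\<close>; the index \<open>m\<close> comes from the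
    shift by \<open>fps_X\<close>.\<close>
  also have "\<dots> = fact n * (7 * (E7 ^ 3 * P ^ 4) $ n + 49 * (E7 ^ 7 * P ^ 8) $ m)"
    by (simp add: m algebra_simps)
  also have "\<dots> = of_real (fact n * real (num_partitions (7 * n + 5)))"
    unfolding coeff[symmetric] by simp
  finally show ?thesis by (simp only: of_real_eq_iff)
qed

end
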